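(* Let $\Omega\subset\mathbb{R}^2$ be a bounded polygonal domain, $X=H^2_0(\Omega)$, $Re>0$, $Ro>0$, $F\in H^{-2}(\Omega)$, and let $X^h\subset X$ be a conforming finite element space. Define for $\zeta,\psi,\chi\in X$ $$a_0(\psi,\chi)=Re^{-1}\int_\Omega\Delta\psi\,\Delta\chi\,d\mathbf x,\quad a_1(\zeta,\psi,\chi)=\int_\Omega\Delta\zeta\,(\psi_y\chi_x-\psi_x\chi_y)\,d\mathbf x,$$ $$a_2(\psi,\chi)=-Ro^{-1}\int_\Omega\psi_x\chi\,d\mathbf x,\quad \ell(\chi)=Ro^{-1}\int_\Omega F\chi\,d\mathbf x.$$ Let $\psi\in X$ satisfy $a_0(\psi,\chi)+a_1(\psi,\psi,\chi)+a_2(\psi,\chi)=\ell(\chi)$ for all $\chi\in X$, and let $\psi^h\in X^h$ satisfy $a_0(\psi^h,\chi^h)+a_1(\psi^h,\psi^h,\chi^h)+a_2(\psi^h,\chi^h)=\ell(\chi^h)$ for all $\chi^h\in X^h$. Assume the small data condition $Re^{-2}\,Ro\ge\Gamma_1\|F\|_{-2}$. Then $$|\psi-\psi^h|_2\le C(Re,Ro,\Gamma_1,\Gamma_2,F)\inf_{\chi^h\in X^h}|\psi-\chi^h|_2,$$ where $$C(Re,Ro,\Gamma_1,\Gamma_2,F)=\frac{Ro^{-1}\Gamma_2+2Re^{-1}+\Gamma_1 Re\,Ro^{-1}\|F\|_{-2}}{Re^{-1}-\Gamma_1 Re\,Ro^{-1}\|F\|_{-2}}.$$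
   Context: $H^2_0(\Omega)=\{\psi\in H^2(\Omega):\psi=\partial\psi/\partial\mathbf{n}=0\text{ on }\partial\Omega\}$; $|\cdot|_2$ is the $H^2$-seminorm ($=\|\Delta\cdot\|_{L^2}$ on $H^2_0$), and $\|F\|_{-2}=\sup_{0\ne\chi\in H^2_0}|\int_\Omega F\chi|/|\chi|_2$. $\Gamma_1>0$ is a constant with $|a_1(\zeta,\psi,\chi)|\le\Gamma_1|\zeta|_2|\psi|_2|\chi|_2$ for all $\zeta,\psi,\chi\in X$, and $\Gamma_2>0$ is a constant with $|a_2(\psi,\chi)|\le Ro^{-1}\Gamma_2|\psi|_2|\chi|_2$ for all $\psi,\chi\in X$. Subscripts $x,y$ denote partial derivatives. *)

theory Defs
  imports "HOL-Analysis.Analysis"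
begin

type_synonym R2 = "real \<times> real"

definition polygonal_domain :: "R2 set \<Rightarrow> bool" where
  "polygonal_domain \<Omega> \<longleftrightarrow> open \<Omega> \<and> connected \<Omega> \<and> bounded \<Omega> \<and> \<Omega> \<noteq> {} \<and>
     (\<exists>S :: (R2 \<times> R2) set. finite S \<and> frontier \<Omega> = (\<Union>(a,b)\<in>S. closed_segment a b))"

definition pdx :: "(R2 \<Rightarrow> real) \<Rightarrow> R2 \<Rightarrow> real" where
  "pdx f p = deriv (\<lambda>t. f (t, snd p)) (fst p)"
definition pdy :: "(R2 \<Rightarrow> real) \<Rightarrow> R2 \<Rightarrow> real" where
  "pdy f p = deriv (\<lambda>t. f (fst p, t)) (snd p)"

fun pdw :: "bool list \<Rightarrow> (R2 \<Rightarrow> real) \<Rightarrow> R2 \<Rightarrow> real" where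
  "pdw [] f = f"
| "pdw (b # w) f = (if b then pdx else pdy) (pdw w f)"

definition pd :: "nat \<Rightarrow> nat \<Rightarrow> (R2 \<Rightarrow> real) \<Rightarrow> R2 \<Rightarrow> real" where
  "pd i j f = pdw (replicate i True @ replicate j False) f"

definition smooth :: "(R2 \<Rightarrow> real) \<Rightarrow> bool" where
  "smooth f \<longleftrightarrow> (\<forall>w. continuous_on UNIV (pdw w f) \<and> (\<forall>p. pdw w f differentiable (at p)))"

definition test_fun :: "R2 set \<Rightarrow> (R2 \<Rightarrow> real) \<Rightarrow> bool" where
  "test_fun \<Omega> \<phi> \<longleftrightarrow> smooth \<phi> \<and> compact (closure {p. \<phi> p \<noteq> 0}) \<and> closure {p. \<phi> p \<noteq> 0} \<subseteq> \<Omega>"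

definition L2 :: "R2 set \<Rightarrow> (R2 \<Rightarrow> real) \<Rightarrow> bool" where
  "L2 \<Omega> g \<longleftrightarrow> set_borel_measurable lborel \<Omega> g \<and> set_integrable lborel \<Omega> (\<lambda>p. (g p)\<^sup>2)"

definition weak_deriv :: "R2 set \<Rightarrow> nat \<Rightarrow> nat \<Rightarrow> (R2 \<Rightarrow> real) \<Rightarrow> (R2 \<Rightarrow> real) \<Rightarrow> bool" where
  "weak_deriv \<Omega> i j u g \<longleftrightarrow> (\<forall>\<phi>. test_fun \<Omega> \<phi> \<longrightarrow>
      (LINT p:\<Omega>|lborel. u p * pd i j \<phi> p) = (-1) ^ (i + j) * (LINT p:\<Omega>|lborel. g p * \<phi> p))"

definition H2 :: "R2 set \<Rightarrow> (R2 \<Rightarrow> real) \<Rightarrow> bool" where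
  "H2 \<Omega> u \<longleftrightarrow> L2 \<Omega> u \<and> (\<forall>i j. i + j \<le> 2 \<longrightarrow> (\<exists>g. L2 \<Omega> g \<and> weak_deriv \<Omega> i j u g))"

definition wd :: "R2 set \<Rightarrow> nat \<Rightarrow> nat \<Rightarrow> (R2 \<Rightarrow> real) \<Rightarrow> R2 \<Rightarrow> real" where
  "wd \<Omega> i j u = (SOME g. L2 \<Omega> g \<and> weak_deriv \<Omega> i j u g)"

definition H2_norm :: "R2 set \<Rightarrow> (R2 \<Rightarrow> real) \<Rightarrow> real" where
  "H2_norm \<Omega> u = sqrt (\<Sum>(i,j)\<in>{(i,j). i + j \<le> (2::nat)}. LINT p:\<Omega>|lborel. (wd \<Omega> i j u p)\<^sup>2)"

definition H20 :: "R2 set \<Rightarrow> (R2 \<Rightarrow> real) set" where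
  "H20 \<Omega> = {u. H2 \<Omega> u \<and> (\<exists>\<phi>s. (\<forall>n. test_fun \<Omega> (\<phi>s n)) \<and>
       (\<lambda>n. H2_norm \<Omega> (\<lambda>p. \<phi>s n p - u p)) \<longlonglongrightarrow> 0)}"

text \<open>H^2 seminorm |u|_2 (Frobenius norm of the Hessian in L^2).\<close>
definition H2_semi :: "R2 set \<Rightarrow> (R2 \<Rightarrow> real) \<Rightarrow> real" where
  "H2_semi \<Omega> u = sqrt (LINT p:\<Omega>|lborel.
      (wd \<Omega> 2 0 u p)\<^sup>2 + 2 * (wd \<Omega> 1 1 u p)\<^sup>2 + (wd \<Omega> 0 2 u p)\<^sup>2)"

definition lap :: "R2 set \<Rightarrow> (R2 \<Rightarrow> real) \<Rightarrow> R2 \<Rightarrow> real" where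
  "lap \<Omega> u p = wd \<Omega> 2 0 u p + wd \<Omega> 0 2 u p"

text \<open>Elements of H^{-2}(Omega): bounded linear functionals on H^2_0(Omega);
  F chi stands for the pairing "integral of F chi".\<close>
definition Hminus2 :: "R2 set \<Rightarrow> ((R2 \<Rightarrow> real) \<Rightarrow> real) \<Rightarrow> bool" where
  "Hminus2 \<Omega> F \<longleftrightarrow>
     (\<forall>u\<in>H20 \<Omega>. \<forall>v\<in>H20 \<Omega>. F (\<lambda>p. u p + v p) = F u + F v) \<and>
     (\<forall>c. \<forall>u\<in>H20 \<Omega>. F (\<lambda>p. c * u p) = c * F u) \<and>
     (\<exists>B. \<forall>u\<in>H20 \<Omega>. \<bar>F u\<bar> \<le> B * H2_semi \<Omega> u)"

definition dual_norm :: "R2 set \<Rightarrow> ((R2 \<Rightarrow> real) \<Rightarrow> real) \<Rightarrow> real" where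
  "dual_norm \<Omega> F = Sup ((\<lambda>v. \<bar>F v\<bar> / H2_semi \<Omega> v) ` {v \<in> H20 \<Omega>. H2_semi \<Omega> v \<noteq> 0})"

definition a0 :: "R2 set \<Rightarrow> real \<Rightarrow> (R2 \<Rightarrow> real) \<Rightarrow> (R2 \<Rightarrow> real) \<Rightarrow> real" where
  "a0 \<Omega> Rey \<psi> v = inverse Rey * (LINT p:\<Omega>|lborel. lap \<Omega> \<psi> p * lap \<Omega> v p)"

definition a1 :: "R2 set \<Rightarrow> (R2 \<Rightarrow> real) \<Rightarrow> (R2 \<Rightarrow> real) \<Rightarrow> (R2 \<Rightarrow> real) \<Rightarrow> real" where
  "a1 \<Omega> z \<psi> v = (LINT p:\<Omega>|lborel. lap \<Omega> z p *
      (wd \<Omega> 0 1 \<psi> p * wd \<Omega> 1 0 v p - wd \<Omega> 1 0 \<psi> p * wd \<Omega> 0 1 v p))"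

definition a2 :: "R2 set \<Rightarrow> real \<Rightarrow> (R2 \<Rightarrow> real) \<Rightarrow> (R2 \<Rightarrow> real) \<Rightarrow> real" where
  "a2 \<Omega> Ross \<psi> v = - inverse Ross * (LINT p:\<Omega>|lborel. wd \<Omega> 1 0 \<psi> p * v p)"

definition ell :: "real \<Rightarrow> ((R2 \<Rightarrow> real) \<Rightarrow> real) \<Rightarrow> (R2 \<Rightarrow> real) \<Rightarrow> real" where
  "ell Ross F v = inverse Ross * F v"

definition conforming_fe_space :: "R2 set \<Rightarrow> (R2 \<Rightarrow> real) set \<Rightarrow> bool" where
  "conforming_fe_space \<Omega> Xh \<longleftrightarrow> Xh \<subseteq> H20 \<Omega> \<and> (\<lambda>p. 0) \<in> Xh \<and>
     (\<forall>u\<in>Xh. \<forall>v\<in>Xh. (\<lambda>p. u p + v p) \<in> Xh) \<and>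
     (\<forall>c. \<forall>u\<in>Xh. (\<lambda>p. c * u p) \<in> Xh) \<and>
     (\<exists>B. finite B \<and> B \<subseteq> Xh \<and> (\<forall>v\<in>Xh. \<exists>c. v = (\<lambda>p. \<Sum>b\<in>B. c b * b p)))"

end

theory Submission
  imports Defs
begin

text \<open>Write \<open>\<psi> - \<psi>\<^sub>h = \<eta> + \<xi>\<close> with \<open>\<eta> = \<psi> - v\<^sub>h\<close> and \<open>\<xi> = v\<^sub>h - \<psi>\<^sub>h \<in> X\<^sub>h\<close>, and test the
  difference of the two equations with \<open>\<xi>\<close>. Since \<open>a1 \<Omega> \<zeta> \<xi> \<xi> = 0\<close> and \<open>a2 \<Omega> Ross \<xi> \<xi> = 0\<close>, what
  remains is \<open>a0 \<Omega> Rey \<xi> \<xi>\<close> against terms that are linear in \<open>\<eta>\<close> or contain \<open>a1 \<Omega> \<xi> \<psi> \<xi>\<close>, which the small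
  data condition absorbs through the a priori bound \<open>Rey / Ross * dual_norm \<Omega> F\<close> on both solutions.

  Splitting the forms additively needs three analytic facts. Weak derivatives are unique almost
  everywhere, so \<open>wd\<close>, a Hilbert choice, is linear almost everywhere. On \<open>H20 \<Omega>\<close> the identities
  for test functions survive by density. The integrand of \<open>a1\<close> is integrable (otherwise the integral
  would be the junk value 0) because products of first derivatives are square integrable, by a
  Ladyzhenskaya-type inequality and Fatou's lemma.\<close>

section \<open>Square-integrable functions\<close>

text \<open>Origin of the constant: let
  \<open>N = Rey * inverse Ross * dual_norm \<Omega> F\<close>. The terms linear in \<eta>
  contribute \<open>inverse Rey\<close> from \<open>a0\<close>, \<open>\<Gamma>1 * N\<close> twice
  from \<open>a1\<close>, and \<open>inverse Ross * \<Gamma>2\<close> from \<open>a2\<close>.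
  Returning from \<xi> to the full error by the triangle inequality adds the absorbed coefficient
  \<open>inverse Rey - \<Gamma>1 * N\<close> once more. This doubles \<open>inverse Rey\<close> and
  cancels one of the two \<open>\<Gamma>1 * N\<close>. When the small data condition holds with
  equality, that coefficient, the denominator of C, is zero; hence the estimate is stated multiplied
  out.

  The obstacle that shapes the calculus part is the order of differentiation. \<open>pd\<close>
  fixes one order, integration by parts produces the other, and \<open>smooth\<close> only says that
  both exist and are regular. So even "the classical derivative of a test function is its weak
  derivative" needs symmetry of second derivatives. It is obtained almost everywhere, from the same
  variational lemma that gives uniqueness, by testing against products of functions of one
  variable.\<close>

definition square_integrable :: "'a measure \<Rightarrow> ('a \<Rightarrow> real) \<Rightarrow> bool" where
  "square_integrable M f \<longleftrightarrow> f \<in> borel_measurable M \<and> integrable M (\<lambda>x. (f x)\<^sup>2)"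

lemma square_integrableD:
  assumes "square_integrable M f"
  shows "f \<in> borel_measurable M" "integrable M (\<lambda>x. (f x)\<^sup>2)"
  using assms by (auto simp: square_integrable_def)

lemma abs_mult_le_squares: "\<bar>a * b\<bar> \<le> a\<^sup>2 + (b::real)\<^sup>2"
proof -
  have "2 * \<bar>a\<bar> * \<bar>b\<bar> \<le> \<bar>a\<bar>\<^sup>2 + \<bar>b\<bar>\<^sup>2" by (rule sum_squares_bound)
  moreover have "0 \<le> \<bar>a\<bar> * \<bar>b\<bar>" by simp
  ultimately show ?thesis unfolding abs_mult power2_abs mult.assoc by linarith
qed

lemma square_integrable_mult:
  assumes "square_integrable M f" "square_integrable M g"
  shows "integrable M (\<lambda>x. f x * g x)"
proof (rule Bochner_Integration.integrable_bound)
  show "integrable M (\<lambda>x. (f x)\<^sup>2 + (g x)\<^sup>2)"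
    using assms by (auto simp: square_integrable_def)
  show "(\<lambda>x. f x * g x) \<in> borel_measurable M"
    using assms by (intro borel_measurable_times) (auto simp: square_integrable_def)
  show "AE x in M. norm (f x * g x) \<le> norm ((f x)\<^sup>2 + (g x)\<^sup>2)"
    using abs_mult_le_squares by auto
qed

lemma square_integrable_cmult:
  "square_integrable M f \<Longrightarrow> square_integrable M (\<lambda>x. c * f x)"
  by (auto simp: square_integrable_def power_mult_distrib)

lemma square_integrable_add:
  assumes "square_integrable M f" "square_integrable M g"
  shows "square_integrable M (\<lambda>x. f x + g x)"
  using assms square_integrable_mult[OF assms]
  by (auto simp: square_integrable_def power2_sum mult.assoc intro!: borel_measurable_add)

lemma square_integrable_diff:
  assumes "square_integrable M f" "square_integrable M g"
  shows "square_integrable M (\<lambda>x. f x - g x)"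
  using square_integrable_add[OF assms(1) square_integrable_cmult[OF assms(2), of "-1"]] by simp

lemma square_integrable_integrable:
  assumes "finite_measure M" "square_integrable M f"
  shows "integrable M f"
proof -
  interpret finite_measure M by fact
  have "square_integrable M (\<lambda>_. 1)" by (simp add: square_integrable_def)
  from square_integrable_mult[OF assms(2) this] show ?thesis by simp
qed

lemma Cauchy_Schwarz_integral:
  assumes f: "square_integrable M f" and g: "square_integrable M g"
  shows "\<bar>\<integral>x. f x * g x \<partial>M\<bar> \<le> sqrt (\<integral>x. (f x)\<^sup>2 \<partial>M) * sqrt (\<integral>x. (g x)\<^sup>2 \<partial>M)"
proof -
  define A B C where "A = (\<integral>x. (f x)\<^sup>2 \<partial>M)" and "B = (\<integral>x. f x * g x \<partial>M)"
    and "C = (\<integral>x. (g x)\<^sup>2 \<partial>M)"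
  \<comment> \<open>Keeping both parameters makes the quadratic form homogeneous, so that no
    division by \<open>C\<close> is needed.\<close>
  have pos: "0 \<le> A * t\<^sup>2 + 2 * B * t * s + C * s\<^sup>2" for t s
  proof -
    have "0 \<le> (\<integral>x. (t * f x + s * g x)\<^sup>2 \<partial>M)" by simp
    also have "\<dots> = (\<integral>x. t\<^sup>2 * (f x)\<^sup>2 + (2 * t * s) * (f x * g x) + s\<^sup>2 * (g x)\<^sup>2 \<partial>M)"
      by (rule Bochner_Integration.integral_cong) (auto simp: power2_eq_square algebra_simps)
    also have "\<dots> = t\<^sup>2 * A + (2 * t * s) * B + s\<^sup>2 * C"
      using square_integrableD(2)[OF f] square_integrableD(2)[OF g] square_integrable_mult[OF f g]
      by (simp add: A_def B_def C_def)
    finally show ?thesis by (simp add: algebra_simps)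
  qed
  have nn: "0 \<le> A" "0 \<le> C" by (simp_all add: A_def C_def)
  have "B\<^sup>2 \<le> A * C"
  proof (cases "C = 0")
    case True
    have "B = 0"
    proof (rule ccontr)
      assume B: "B \<noteq> 0"
      \<comment> \<open>With \<open>C = 0\<close> the form is affine in \<open>s\<close>; this
        \<open>s\<close> gives it the value -1.\<close>
      have "0 \<le> A * 1\<^sup>2 + 2 * B * 1 * (- (A + 1) / (2 * B)) + C * (- (A + 1) / (2 * B))\<^sup>2"
        by (rule pos)
      then show False using True B by simp
    qed
    then show ?thesis using True by simp
  next
    case False
    \<comment> \<open>At \<open>t = C\<close>, \<open>s = - B\<close> the form becomes
      \<open>C\<close> times the discriminant.\<close>
    have "0 \<le> A * C\<^sup>2 + 2 * B * C * (-B) + C * (-B)\<^sup>2" by (rule pos)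
    then have "0 \<le> C * (A * C - B\<^sup>2)" by (simp add: power2_eq_square algebra_simps)
    then show ?thesis using False nn by (simp add: zero_le_mult_iff)
  qed
  then have "sqrt (B\<^sup>2) \<le> sqrt (A * C)" by (rule real_sqrt_le_mono)
  then show ?thesis by (simp add: real_sqrt_mult A_def B_def C_def)
qed

lemma sqrt_integral_triangle:
  assumes f: "square_integrable M f" and g: "square_integrable M g"
  shows "sqrt (\<integral>x. (f x + g x)\<^sup>2 \<partial>M) \<le> sqrt (\<integral>x. (f x)\<^sup>2 \<partial>M) + sqrt (\<integral>x. (g x)\<^sup>2 \<partial>M)"
proof (rule real_le_lsqrt)
  have "(\<integral>x. (f x + g x)\<^sup>2 \<partial>M) = (\<integral>x. (f x)\<^sup>2 + (g x)\<^sup>2 + 2 * (f x * g x) \<partial>M)"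
    by (rule Bochner_Integration.integral_cong) (auto simp: power2_eq_square algebra_simps)
  also have "\<dots> = (\<integral>x. (f x)\<^sup>2 \<partial>M) + (\<integral>x. (g x)\<^sup>2 \<partial>M) + 2 * (\<integral>x. f x * g x \<partial>M)"
    using square_integrableD(2)[OF f] square_integrableD(2)[OF g] square_integrable_mult[OF f g]
    by simp
  also have "\<dots> \<le> (\<integral>x. (f x)\<^sup>2 \<partial>M) + (\<integral>x. (g x)\<^sup>2 \<partial>M)
      + 2 * (sqrt (\<integral>x. (f x)\<^sup>2 \<partial>M) * sqrt (\<integral>x. (g x)\<^sup>2 \<partial>M))"
    using Cauchy_Schwarz_integral[OF f g] by linarith
  also have "\<dots> = (sqrt (\<integral>x. (f x)\<^sup>2 \<partial>M) + sqrt (\<integral>x. (g x)\<^sup>2 \<partial>M))\<^sup>2"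
    by (simp add: power2_sum)
  finally show "(\<integral>x. (f x + g x)\<^sup>2 \<partial>M) \<le> (sqrt (\<integral>x. (f x)\<^sup>2 \<partial>M) + sqrt (\<integral>x. (g x)\<^sup>2 \<partial>M))\<^sup>2" .
qed simp_all

lemma integral_square_add_tendsto_0:
  assumes "\<And>n. square_integrable M (f n)" "\<And>n. square_integrable M (g n)"
    and f: "(\<lambda>n. \<integral>x. (f n x)\<^sup>2 \<partial>M) \<longlonglongrightarrow> 0" and g: "(\<lambda>n. \<integral>x. (g n x)\<^sup>2 \<partial>M) \<longlonglongrightarrow> 0"
  shows "(\<lambda>n. \<integral>x. (f n x + g n x)\<^sup>2 \<partial>M) \<longlonglongrightarrow> 0"
proof -
  have "(\<lambda>n. sqrt (\<integral>x. (f n x)\<^sup>2 \<partial>M) + sqrt (\<integral>x. (g n x)\<^sup>2 \<partial>M)) \<longlonglongrightarrow> sqrt 0 + sqrt 0"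
    by (intro tendsto_intros f g)
  then have lim: "(\<lambda>n. sqrt (\<integral>x. (f n x)\<^sup>2 \<partial>M) + sqrt (\<integral>x. (g n x)\<^sup>2 \<partial>M)) \<longlonglongrightarrow> 0"
    by simp
  have "(\<lambda>n. sqrt (\<integral>x. (f n x + g n x)\<^sup>2 \<partial>M)) \<longlonglongrightarrow> 0"
    by (rule tendsto_sandwich[OF _ _ tendsto_const lim])
       (auto intro!: always_eventually sqrt_integral_triangle assms)
  then have "(\<lambda>n. (sqrt (\<integral>x. (f n x + g n x)\<^sup>2 \<partial>M))\<^sup>2) \<longlonglongrightarrow> 0\<^sup>2"
    by (rule tendsto_power)
  then show ?thesis by simp
qed

text \<open>This is the device that carries integral identities from test functions over to
  \<open>H20\<close>: the L2 pairing is continuous in both factors jointly.\<close>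

lemma integral_mult_tendsto:
  assumes fn: "\<And>n. square_integrable M (f n)" and gn: "\<And>n. square_integrable M (g n)"
    and f0: "square_integrable M f0" and g0: "square_integrable M g0"
    and f: "(\<lambda>n. \<integral>x. (f n x - f0 x)\<^sup>2 \<partial>M) \<longlonglongrightarrow> 0"
    and g: "(\<lambda>n. \<integral>x. (g n x - g0 x)\<^sup>2 \<partial>M) \<longlonglongrightarrow> 0"
  shows "(\<lambda>n. \<integral>x. f n x * g n x \<partial>M) \<longlonglongrightarrow> (\<integral>x. f0 x * g0 x \<partial>M)"
proof -
  note df = square_integrable_diff[OF fn f0] and dg = square_integrable_diff[OF gn g0]
  define S where "S h = sqrt (\<integral>x. (h x)\<^sup>2 \<partial>M)" for h :: "'a \<Rightarrow> real"
  \<comment> \<open>In this splitting only norms of differences and of the limits occur, so no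
    boundedness of the two sequences has to be shown.\<close>
  define D where "D n = S (\<lambda>x. f n x - f0 x) * S (\<lambda>x. g n x - g0 x) + S f0 * S (\<lambda>x. g n x - g0 x)
    + S (\<lambda>x. f n x - f0 x) * S g0" for n
  have "D \<longlonglongrightarrow> sqrt 0 * sqrt 0 + S f0 * sqrt 0 + sqrt 0 * S g0"
    unfolding D_def S_def by (intro tendsto_intros f g)
  then have D: "D \<longlonglongrightarrow> 0" by simp
  have "\<bar>(\<integral>x. f n x * g n x \<partial>M) - (\<integral>x. f0 x * g0 x \<partial>M)\<bar> \<le> D n" for n
  proof -
    have "(\<integral>x. f n x * g n x \<partial>M) - (\<integral>x. f0 x * g0 x \<partial>M) = (\<integral>x. f n x * g n x - f0 x * g0 x \<partial>M)"
      by (simp add: square_integrable_mult fn gn f0 g0)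
    also have "\<dots> = (\<integral>x. ((f n x - f0 x) * (g n x - g0 x) + f0 x * (g n x - g0 x))
        + (f n x - f0 x) * g0 x \<partial>M)"
      by (rule Bochner_Integration.integral_cong) (auto simp: algebra_simps)
    also have "\<dots> = (\<integral>x. (f n x - f0 x) * (g n x - g0 x) \<partial>M) + (\<integral>x. f0 x * (g n x - g0 x) \<partial>M)
        + (\<integral>x. (f n x - f0 x) * g0 x \<partial>M)"
      using square_integrable_mult[OF df[of n] dg[of n]] square_integrable_mult[OF f0 dg[of n]]
        square_integrable_mult[OF df[of n] g0]
      by (simp only: Bochner_Integration.integral_add Bochner_Integration.integrable_add)
    finally show ?thesis
      using Cauchy_Schwarz_integral[OF df[of n] dg[of n]] Cauchy_Schwarz_integral[OF f0 dg[of n]]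
        Cauchy_Schwarz_integral[OF df[of n] g0]
      unfolding D_def S_def by linarith
  qed
  then have "(\<lambda>n. (\<integral>x. f n x * g n x \<partial>M) - (\<integral>x. f0 x * g0 x \<partial>M)) \<longlonglongrightarrow> 0"
    by (intro Lim_null_comparison[OF _ D]) (auto intro!: always_eventually)
  then show ?thesis by (simp add: LIM_zero_iff)
qed

section \<open>Calculus of test functions\<close>

lemma smoothD:
  assumes "smooth f"
  shows "continuous_on UNIV (pdw w f)" "pdw w f differentiable (at p)"
  using assms unfolding smooth_def by blast+

lemma smooth_continuous: "smooth f \<Longrightarrow> continuous_on UNIV f"
  using smoothD(1)[of f "[]"] by simp

lemma smooth_differentiable: "smooth f \<Longrightarrow> f differentiable (at p)"
  using smoothD(2)[of f "[]"] by simp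

lemma pdw_append: "pdw (v @ w) f = pdw v (pdw w f)"
  by (induction v) auto

lemma smooth_pdw: "smooth f \<Longrightarrow> smooth (pdw w f)"
  unfolding smooth_def by (metis pdw_append)

lemma smooth_pdx: "smooth f \<Longrightarrow> smooth (pdx f)"
  using smooth_pdw[of f "[True]"] by simp

lemma smooth_pdy: "smooth f \<Longrightarrow> smooth (pdy f)"
  using smooth_pdw[of f "[False]"] by simp

text \<open>\<open>deriv\<close> carries information only where a derivative exists. The total
  differentiability contained in \<open>smooth\<close> supplies it, by composition with the affine
  embedding of a coordinate line.\<close>

lemma differentiable_slice:
  fixes f :: "R2 \<Rightarrow> real"
  assumes "f differentiable (at p)"
  shows "((\<lambda>t. f (t, snd p)) has_real_derivative pdx f p) (at (fst p))"
    and "((\<lambda>t. f (fst p, t)) has_real_derivative pdy f p) (at (snd p))"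
proof -
  have "((\<lambda>t. (t, snd p)) has_derivative (\<lambda>h. (h, 0))) (at (fst p))"
    by (auto intro!: derivative_eq_intros)
  then have "(\<lambda>t. (t, snd p)) differentiable (at (fst p))" by (rule differentiableI)
  then have "(f \<circ> (\<lambda>t. (t, snd p))) differentiable (at (fst p))"
    using assms by (intro differentiable_chain_at) auto
  then have "(\<lambda>t. f (t, snd p)) field_differentiable (at (fst p))"
    by (simp add: o_def field_differentiable_def real_differentiable_def)
  then show "((\<lambda>t. f (t, snd p)) has_real_derivative pdx f p) (at (fst p))"
    unfolding pdx_def by (rule field_differentiable_derivI)
  have "((\<lambda>t. (fst p, t)) has_derivative (\<lambda>h. (0, h))) (at (snd p))"
    by (auto intro!: derivative_eq_intros)
  then have "(\<lambda>t. (fst p, t)) differentiable (at (snd p))" by (rule differentiableI)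
  then have "(f \<circ> (\<lambda>t. (fst p, t))) differentiable (at (snd p))"
    using assms by (intro differentiable_chain_at) auto
  then have "(\<lambda>t. f (fst p, t)) field_differentiable (at (snd p))"
    by (simp add: o_def field_differentiable_def real_differentiable_def)
  then show "((\<lambda>t. f (fst p, t)) has_real_derivative pdy f p) (at (snd p))"
    unfolding pdy_def by (rule field_differentiable_derivI)
qed

lemma smooth_DERIV_x: "smooth f \<Longrightarrow> ((\<lambda>t. f (t, y)) has_real_derivative pdx f (x, y)) (at x)"
  using differentiable_slice(1)[of f "(x, y)"] smooth_differentiable by simp

lemma smooth_DERIV_y: "smooth f \<Longrightarrow> ((\<lambda>t. f (x, t)) has_real_derivative pdy f (x, y)) (at y)"
  using differentiable_slice(2)[of f "(x, y)"] smooth_differentiable by simp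

lemma pdw_add:
  assumes "smooth f" "smooth g"
  shows "pdw w (\<lambda>p. f p + g p) = (\<lambda>p. pdw w f p + pdw w g p)"
proof (induction w)
  case (Cons b w)
  note smooth_pdw[OF assms(1), of w, THEN smooth_differentiable]
    and smooth_pdw[OF assms(2), of w, THEN smooth_differentiable]
  note D = DERIV_add[OF this(1)[THEN differentiable_slice(1)] this(2)[THEN differentiable_slice(1)]]
    DERIV_add[OF this(1)[THEN differentiable_slice(2)] this(2)[THEN differentiable_slice(2)]]
  show ?case
  proof (cases b)
    case True
    then show ?thesis using D(1)[THEN DERIV_imp_deriv]
      by (simp add: Cons pdx_def[of "\<lambda>p. pdw w f p + pdw w g p"])
  next
    case False
    then show ?thesis using D(2)[THEN DERIV_imp_deriv]
      by (simp add: Cons pdy_def[of "\<lambda>p. pdw w f p + pdw w g p"])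
  qed
qed simp

lemma pdw_cmult:
  assumes "smooth f"
  shows "pdw w (\<lambda>p. c * f p) = (\<lambda>p. c * pdw w f p)"
proof (induction w)
  case (Cons b w)
  note smooth_pdw[OF assms(1), of w, THEN smooth_differentiable]
  note D = DERIV_cmult[OF this[THEN differentiable_slice(1)]]
    DERIV_cmult[OF this[THEN differentiable_slice(2)]]
  show ?case
  proof (cases b)
    case True
    then show ?thesis using D(1)[THEN DERIV_imp_deriv]
      by (simp add: Cons pdx_def[of "\<lambda>p. c * pdw w f p"])
  next
    case False
    then show ?thesis using D(2)[THEN DERIV_imp_deriv]
      by (simp add: Cons pdy_def[of "\<lambda>p. c * pdw w f p"])
  qed
qed simp

lemma smooth_add: "smooth f \<Longrightarrow> smooth g \<Longrightarrow> smooth (\<lambda>p. f p + g p)"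
  by (simp add: smooth_def pdw_add continuous_on_add)

lemma smooth_cmult: "smooth f \<Longrightarrow> smooth (\<lambda>p. c * f p)"
  by (simp add: smooth_def pdw_cmult continuous_on_mult_left)

lemma test_fun_smooth: "test_fun \<Omega> \<phi> \<Longrightarrow> smooth \<phi>"
  by (simp add: test_fun_def)

text \<open>An arbitrary compact set outside which the function vanishes is easier to handle than
  the closed support: sums use a union, and derivatives keep the same set.\<close>

lemma test_fun_iff_compact:
  "test_fun \<Omega> \<phi> \<longleftrightarrow> smooth \<phi> \<and> (\<exists>K. compact K \<and> K \<subseteq> \<Omega> \<and> (\<forall>p. p \<notin> K \<longrightarrow> \<phi> p = 0))"
proof
  assume "test_fun \<Omega> \<phi>"
  then show "smooth \<phi> \<and> (\<exists>K. compact K \<and> K \<subseteq> \<Omega> \<and> (\<forall>p. p \<notin> K \<longrightarrow> \<phi> p = 0))"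
    using closure_subset[of "{p. \<phi> p \<noteq> 0}"] unfolding test_fun_def by blast
next
  assume R: "smooth \<phi> \<and> (\<exists>K. compact K \<and> K \<subseteq> \<Omega> \<and> (\<forall>p. p \<notin> K \<longrightarrow> \<phi> p = 0))"
  then obtain K where K: "compact K" "K \<subseteq> \<Omega>" "{p. \<phi> p \<noteq> 0} \<subseteq> K" by blast
  then have "closure {p. \<phi> p \<noteq> 0} \<subseteq> K"
    by (intro closure_minimal compact_imp_closed)
  moreover from this K(1) have "compact (closure {p. \<phi> p \<noteq> 0})"
    by (metis compact_Int_closed closed_closure inf.absorb2)
  ultimately show "test_fun \<Omega> \<phi>" using K R unfolding test_fun_def by blast
qed

lemma test_fun_add:
  assumes "test_fun \<Omega> f" "test_fun \<Omega> g"
  shows "test_fun \<Omega> (\<lambda>p. f p + g p)"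
proof -
  from assms obtain K L where "compact K" "K \<subseteq> \<Omega>" "\<forall>p. p \<notin> K \<longrightarrow> f p = 0"
    "compact L" "L \<subseteq> \<Omega>" "\<forall>p. p \<notin> L \<longrightarrow> g p = 0"
    unfolding test_fun_iff_compact by blast
  then show ?thesis
    using assms[THEN test_fun_smooth] unfolding test_fun_iff_compact
    by (intro conjI smooth_add exI[of _ "K \<union> L"]) auto
qed

lemma test_fun_cmult: "test_fun \<Omega> f \<Longrightarrow> test_fun \<Omega> (\<lambda>p. c * f p)"
  unfolding test_fun_iff_compact by (auto intro!: smooth_cmult)

lemma pd_zero_outside_closed:
  fixes f :: "R2 \<Rightarrow> real"
  assumes "closed K" and 0: "\<forall>p. p \<notin> K \<longrightarrow> f p = 0" and p: "p \<notin> K"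
  shows "pdx f p = 0" "pdy f p = 0"
proof -
  obtain U V where UV: "open U" "open V" "fst p \<in> U" "snd p \<in> V" "U \<times> V \<subseteq> - K"
    using open_prod_elim[of "-K" p] assms by (metis ComplI mem_Times_iff open_Compl)
  have "\<forall>\<^sub>F t in nhds (fst p). f (t, snd p) = 0"
    using UV 0 by (intro eventually_nhds[THEN iffD2] exI[of _ U]) auto
  then show "pdx f p = 0"
    unfolding pdx_def using deriv_cong_ev[of "\<lambda>t. f (t, snd p)" "\<lambda>_. 0" "fst p" "fst p"] by simp
  have "\<forall>\<^sub>F t in nhds (snd p). f (fst p, t) = 0"
    using UV 0 by (intro eventually_nhds[THEN iffD2] exI[of _ V]) auto
  then show "pdy f p = 0"
    unfolding pdy_def using deriv_cong_ev[of "\<lambda>t. f (fst p, t)" "\<lambda>_. 0" "snd p" "snd p"] by simp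
qed

lemma test_fun_pdx: "test_fun \<Omega> \<phi> \<Longrightarrow> test_fun \<Omega> (pdx \<phi>)"
  unfolding test_fun_iff_compact
  using pd_zero_outside_closed(1) compact_imp_closed smooth_pdx by metis

lemma test_fun_pdy: "test_fun \<Omega> \<phi> \<Longrightarrow> test_fun \<Omega> (pdy \<phi>)"
  unfolding test_fun_iff_compact
  using pd_zero_outside_closed(2) compact_imp_closed smooth_pdy by metis

lemma test_fun_pdw: "test_fun \<Omega> \<phi> \<Longrightarrow> test_fun \<Omega> (pdw w \<phi>)"
  by (induction w) (auto intro: test_fun_pdx test_fun_pdy)

lemma test_fun_pd: "test_fun \<Omega> \<phi> \<Longrightarrow> test_fun \<Omega> (pd i j \<phi>)"
  by (simp add: pd_def test_fun_pdw)

lemma pd_add: "smooth f \<Longrightarrow> smooth g \<Longrightarrow> pd i j (\<lambda>p. f p + g p) = (\<lambda>p. pd i j f p + pd i j g p)"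
  by (simp add: pd_def pdw_add)

lemma pd_cmult: "smooth f \<Longrightarrow> pd i j (\<lambda>p. c * f p) = (\<lambda>p. c * pd i j f p)"
  by (simp add: pd_def pdw_cmult)

lemma pd_simps:
  "pd 0 0 f = f" "pd (Suc 0) 0 f = pdx f" "pd 0 (Suc 0) f = pdy f"
  "pd 1 0 f = pdx f" "pd 0 1 f = pdy f"
  "pd 2 0 f = pdx (pdx f)" "pd 1 1 f = pdx (pdy f)" "pd (Suc 0) (Suc 0) f = pdx (pdy f)"
  "pd 0 2 f = pdy (pdy f)"
  by (simp_all add: pd_def numeral_2_eq_2)

section \<open>Integration by parts for compactly supported functions\<close>

lemma compact_support_square:
  fixes f :: "R2 \<Rightarrow> real"
  assumes "compact K" "\<forall>p. p \<notin> K \<longrightarrow> f p = 0"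
  obtains R where "R > 0" "\<And>x y. \<bar>x\<bar> > R \<or> \<bar>y\<bar> > R \<Longrightarrow> f (x, y) = 0"
proof -
  obtain R where R: "R > 0" "\<forall>p\<in>K. norm p \<le> R"
    using compact_imp_bounded[OF assms(1)] bounded_pos by blast
  have "f (x, y) = 0" if "\<bar>x\<bar> > R \<or> \<bar>y\<bar> > R" for x y
  proof -
    have "(x, y) \<notin> K"
      using that R(2) norm_fst_le[of x y] norm_snd_le[of y x] by (metis real_norm_def linorder_not_le order_trans)
    then show ?thesis using assms(2) by blast
  qed
  then show ?thesis using that R(1) by blast
qed

lemma integrable_compact_support:
  fixes f :: "R2 \<Rightarrow> real"
  assumes "continuous_on UNIV f" "compact K" "\<forall>p. p \<notin> K \<longrightarrow> f p = 0"
  shows "integrable lborel f"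
proof -
  have "integrable lborel (\<lambda>p. indicator K p *\<^sub>R f p)"
    using assms by (intro borel_integrable_compact continuous_on_subset[OF assms(1)]) auto
  moreover have "(\<lambda>p. indicator K p *\<^sub>R f p) = f"
  proof
    fix p show "indicator K p *\<^sub>R f p = f p"
      using assms(3)[rule_format, of p] by (cases "p \<in> K") simp_all
  qed
  ultimately show ?thesis by simp
qed

lemma integral_DERIV_compact_support:
  fixes h h' :: "real \<Rightarrow> real"
  assumes "\<And>t. (h has_real_derivative h' t) (at t)" "continuous_on UNIV h'"
    "\<And>t. \<bar>t\<bar> > R \<Longrightarrow> h t = 0 \<and> h' t = 0" "R > 0"
  shows "(\<integral>t. h' t \<partial>lborel) = 0"
proof -
  \<comment> \<open>The function is known to vanish only strictly beyond \<open>R\<close>, hence the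
    endpoints at distance \<open>R + 1\<close>.\<close>
  have "(\<integral>t. h' t * indicator {- (R + 1)..R + 1} t \<partial>lborel) = h (R + 1) - h (- (R + 1))"
    using assms by (intro integral_FTC_Icc_real)
      (auto simp: continuous_on_eq_continuous_at)
  moreover have "(\<lambda>t. h' t * indicator {- (R + 1)..R + 1} t) = h'"
  proof
    fix t show "h' t * indicator {- (R + 1)..R + 1} t = h' t"
      using assms(3)[of t] assms(4) by (cases "\<bar>t\<bar> > R") (auto simp: indicator_def)
  qed
  ultimately show ?thesis using assms(3)[of "R+1"] assms(3)[of "-(R+1)"] assms(4) by simp
qed

text \<open>Since \<open>h\<close> vanishes far to the left, its square at \<open>x\<close> is the
  integral of \<open>2 * (h t * h' t)\<close> up to \<open>x\<close>, and the integrand is at most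
  the sum of the two squares. The form in \<open>ennreal\<close> lets the bound be integrated over
  slices without integrability conditions.\<close>

lemma square_le_integral_compact_support:
  fixes h h' :: "real \<Rightarrow> real"
  assumes D: "\<And>t. (h has_real_derivative h' t) (at t)" and c: "continuous_on UNIV h'"
    and 0: "\<And>t. \<bar>t\<bar> > R \<Longrightarrow> h t = 0 \<and> h' t = 0" and R: "R > 0"
  shows "ennreal ((h x)\<^sup>2) \<le> (\<integral>\<^sup>+t. ennreal ((h t)\<^sup>2 + (h' t)\<^sup>2) \<partial>lborel)"
proof (cases "x < - R")
  case True
  then show ?thesis using 0[of x] by simp
next
  case False
  have ch: "continuous_on UNIV h"
    using D by (meson DERIV_isCont continuous_at_imp_continuous_on)
  let ?I = "{- (R + 1)..x}"
  let ?F = "\<lambda>t. (h t)\<^sup>2 + (h' t)\<^sup>2"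
  have int: "integrable lborel (\<lambda>t. indicator ?I t *\<^sub>R ?F t)"
    by (intro borel_integrable_compact continuous_intros continuous_on_subset[OF ch]
        continuous_on_subset[OF c]) auto
  have 1: "has_bochner_integral lborel (\<lambda>t. (2 * (h t * h' t)) * indicator ?I t) ((h x)\<^sup>2 - (h (-(R+1)))\<^sup>2)"
    using False R c ch by (intro has_bochner_integral_FTC_Icc_real)
      (auto intro!: derivative_eq_intros D continuous_intros simp: continuous_on_eq_continuous_at)
  have "(h x)\<^sup>2 = (\<integral>t. (2 * (h t * h' t)) * indicator ?I t \<partial>lborel)"
    using has_bochner_integral_integral_eq[OF 1] 0[of "-(R+1)"] R by simp
  also have "\<dots> \<le> (\<integral>t. indicator ?I t *\<^sub>R ?F t \<partial>lborel)"
    using sum_squares_bound[of "h _" "h' _"]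
    by (intro integral_mono int 1[unfolded has_bochner_integral_iff, THEN conjunct1])
       (auto simp: indicator_def mult.assoc)
  finally have "ennreal ((h x)\<^sup>2) \<le> ennreal (\<integral>t. indicator ?I t *\<^sub>R ?F t \<partial>lborel)"
    by (rule ennreal_leI)
  also have "\<dots> = (\<integral>\<^sup>+t. ennreal (indicator ?I t *\<^sub>R ?F t) \<partial>lborel)"
    using int by (intro nn_integral_eq_integral[symmetric]) auto
  also have "\<dots> \<le> (\<integral>\<^sup>+t. ennreal (?F t) \<partial>lborel)"
    by (intro nn_integral_mono) (auto simp: indicator_def)
  finally show ?thesis .
qed

lemma test_fun_integrable_mult:
  assumes "test_fun \<Omega> f" "smooth g"
  shows "integrable lborel (\<lambda>p. f p * g p)"
proof -
  obtain K where "compact K" "\<forall>p. p \<notin> K \<longrightarrow> f p = 0" "smooth f"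
    using assms(1) unfolding test_fun_iff_compact by blast
  then show ?thesis
    using assms(2) by (intro integrable_compact_support[of _ K] continuous_on_mult smooth_continuous) auto
qed

text \<open>On every horizontal line the derivative of the product integrates to zero, and Fubini
  sums up the lines. Compact support of one factor is enough for both steps.\<close>

lemma test_fun_by_parts_x:
  assumes f: "test_fun \<Omega> f" and g: "smooth g"
  shows "(\<integral>p. f p * pdx g p \<partial>lborel) = - (\<integral>p. pdx f p * g p \<partial>lborel)"
proof -
  obtain K where K: "compact K" "\<forall>p. p \<notin> K \<longrightarrow> f p = 0" and sf: "smooth f"
    using f unfolding test_fun_iff_compact by blast
  have K': "\<forall>p. p \<notin> K \<longrightarrow> pdx f p = 0"
    using pd_zero_outside_closed(1)[OF compact_imp_closed[OF K(1)] K(2)] by blast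
  \<comment> \<open>The sum of absolute values makes one \<open>R\<close> serve the function and its
    derivative.\<close>
  obtain R where R: "R > 0" "\<And>x y. \<bar>x\<bar> > R \<or> \<bar>y\<bar> > R \<Longrightarrow> \<bar>f (x, y)\<bar> + \<bar>pdx f (x, y)\<bar> = 0"
    using compact_support_square[OF K(1), of "\<lambda>p. \<bar>f p\<bar> + \<bar>pdx f p\<bar>"] K K' by auto
  have R': "f (x, y) = 0 \<and> pdx f (x, y) = 0" if "\<bar>x\<bar> > R \<or> \<bar>y\<bar> > R" for x y
    using R(2)[OF that] by auto
  let ?h = "\<lambda>p. f p * pdx g p + pdx f p * g p"
  note i = test_fun_integrable_mult[OF f smooth_pdx[OF g]]
    test_fun_integrable_mult[OF test_fun_pdx[OF f] g]
  have int: "integrable (lborel \<Otimes>\<^sub>M lborel) (\<lambda>(x, y). ?h (x, y))"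
    using Bochner_Integration.integrable_add[OF i] by (simp add: lborel_prod case_prod_beta')
  have c: "continuous_on UNIV (\<lambda>t. ?h (t, y))" for y
    using g sf smooth_continuous smooth_pdx
    by (intro continuous_intros continuous_on_compose2[of UNIV _ UNIV "\<lambda>t. (t, y)"]) auto
  have "(\<integral>x. ?h (x, y) \<partial>lborel) = 0" for y
    by (rule integral_DERIV_compact_support[of "\<lambda>t. f (t, y) * g (t, y)" _ R])
       (use R(1) R' c in \<open>auto intro!: derivative_eq_intros smooth_DERIV_x sf g\<close>)
  then have "0 = (\<integral>y. (\<integral>x. ?h (x, y) \<partial>lborel) \<partial>lborel)" by simp
  also have "\<dots> = (\<integral>p. ?h p \<partial>lborel)"
    using lborel_pair.integral_snd[OF int] by (simp add: lborel_prod case_prod_beta')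
  also have "\<dots> = (\<integral>p. f p * pdx g p \<partial>lborel) + (\<integral>p. pdx f p * g p \<partial>lborel)"
    using i by simp
  finally show ?thesis by simp
qed

lemma test_fun_by_parts_y:
  assumes f: "test_fun \<Omega> f" and g: "smooth g"
  shows "(\<integral>p. f p * pdy g p \<partial>lborel) = - (\<integral>p. pdy f p * g p \<partial>lborel)"
proof -
  obtain K where K: "compact K" "\<forall>p. p \<notin> K \<longrightarrow> f p = 0" and sf: "smooth f"
    using f unfolding test_fun_iff_compact by blast
  have K': "\<forall>p. p \<notin> K \<longrightarrow> pdy f p = 0"
    using pd_zero_outside_closed(2)[OF compact_imp_closed[OF K(1)] K(2)] by blast
  obtain R where R: "R > 0" "\<And>x y. \<bar>x\<bar> > R \<or> \<bar>y\<bar> > R \<Longrightarrow> \<bar>f (x, y)\<bar> + \<bar>pdy f (x, y)\<bar> = 0"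
    using compact_support_square[OF K(1), of "\<lambda>p. \<bar>f p\<bar> + \<bar>pdy f p\<bar>"] K K' by auto
  have R': "f (x, y) = 0 \<and> pdy f (x, y) = 0" if "\<bar>x\<bar> > R \<or> \<bar>y\<bar> > R" for x y
    using R(2)[OF that] by auto
  let ?h = "\<lambda>p. f p * pdy g p + pdy f p * g p"
  note i = test_fun_integrable_mult[OF f smooth_pdy[OF g]]
    test_fun_integrable_mult[OF test_fun_pdy[OF f] g]
  have int: "integrable (lborel \<Otimes>\<^sub>M lborel) (\<lambda>(x, y). ?h (x, y))"
    using Bochner_Integration.integrable_add[OF i] by (simp add: lborel_prod case_prod_beta')
  have c: "continuous_on UNIV (\<lambda>t. ?h (x, t))" for x
    using g sf smooth_continuous smooth_pdy
    by (intro continuous_intros continuous_on_compose2[of UNIV _ UNIV "\<lambda>t. (x, t)"]) auto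
  have "(\<integral>y. ?h (x, y) \<partial>lborel) = 0" for x
    by (rule integral_DERIV_compact_support[of "\<lambda>t. f (x, t) * g (x, t)" _ R])
       (use R(1) R' c in \<open>auto intro!: derivative_eq_intros smooth_DERIV_y sf g\<close>)
  then have "0 = (\<integral>x. (\<integral>y. ?h (x, y) \<partial>lborel) \<partial>lborel)" by simp
  also have "\<dots> = (\<integral>p. ?h p \<partial>lborel)"
    using lborel_pair.integral_fst[OF int] by (simp add: lborel_prod case_prod_beta')
  also have "\<dots> = (\<integral>p. f p * pdy g p \<partial>lborel) + (\<integral>p. pdy f p * g p \<partial>lborel)"
    using i by simp
  finally show ?thesis by simp
qed

section \<open>Slice bounds and the Ladyzhenskaya-type inequality\<close>

lemma test_fun_square_le_slice_x:
  assumes f: "test_fun \<Omega> f"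
  shows "ennreal ((f (x, y))\<^sup>2) \<le> (\<integral>\<^sup>+t. ennreal ((f (t, y))\<^sup>2 + (pdx f (t, y))\<^sup>2) \<partial>lborel)"
proof -
  obtain K where K: "compact K" "\<forall>p. p \<notin> K \<longrightarrow> f p = 0" and sf: "smooth f"
    using f unfolding test_fun_iff_compact by blast
  have K': "\<forall>p. p \<notin> K \<longrightarrow> pdx f p = 0"
    using pd_zero_outside_closed(1)[OF compact_imp_closed[OF K(1)] K(2)] by blast
  obtain R where R: "R > 0" "\<And>x y. \<bar>x\<bar> > R \<or> \<bar>y\<bar> > R \<Longrightarrow> \<bar>f (x, y)\<bar> + \<bar>pdx f (x, y)\<bar> = 0"
    using compact_support_square[OF K(1), of "\<lambda>p. \<bar>f p\<bar> + \<bar>pdx f p\<bar>"] K K' by auto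
  have R': "f (x, y) = 0 \<and> pdx f (x, y) = 0" if "\<bar>x\<bar> > R \<or> \<bar>y\<bar> > R" for x y
    using R(2)[OF that] by auto
  have "continuous_on UNIV (\<lambda>t. pdx f (t, y))"
    using sf smooth_continuous smooth_pdx
    by (intro continuous_intros continuous_on_compose2[of UNIV _ UNIV "\<lambda>t. (t, y)"]) auto
  then show ?thesis
    using R' R(1) by (intro square_le_integral_compact_support smooth_DERIV_x sf) auto
qed

lemma test_fun_square_le_slice_y:
  assumes f: "test_fun \<Omega> f"
  shows "ennreal ((f (x, y))\<^sup>2) \<le> (\<integral>\<^sup>+t. ennreal ((f (x, t))\<^sup>2 + (pdy f (x, t))\<^sup>2) \<partial>lborel)"
proof -
  obtain K where K: "compact K" "\<forall>p. p \<notin> K \<longrightarrow> f p = 0" and sf: "smooth f"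
    using f unfolding test_fun_iff_compact by blast
  have K': "\<forall>p. p \<notin> K \<longrightarrow> pdy f p = 0"
    using pd_zero_outside_closed(2)[OF compact_imp_closed[OF K(1)] K(2)] by blast
  obtain R where R: "R > 0" "\<And>x y. \<bar>x\<bar> > R \<or> \<bar>y\<bar> > R \<Longrightarrow> \<bar>f (x, y)\<bar> + \<bar>pdy f (x, y)\<bar> = 0"
    using compact_support_square[OF K(1), of "\<lambda>p. \<bar>f p\<bar> + \<bar>pdy f p\<bar>"] K K' by auto
  have R': "f (x, y) = 0 \<and> pdy f (x, y) = 0" if "\<bar>x\<bar> > R \<or> \<bar>y\<bar> > R" for x y
    using R(2)[OF that] by auto
  have "continuous_on UNIV (\<lambda>t. pdy f (x, t))"
    using sf smooth_continuous smooth_pdy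
    by (intro continuous_intros continuous_on_compose2[of UNIV _ UNIV "\<lambda>t. (x, t)"]) auto
  then show ?thesis
    using R' R(1) by (intro square_le_integral_compact_support smooth_DERIV_y sf) auto
qed

lemma smooth_borel_measurable:
  assumes "smooth f"
  shows "f \<in> borel_measurable (lborel \<Otimes>\<^sub>M lborel)" "f \<in> borel_measurable borel"
  using borel_measurable_continuous_onI[OF smooth_continuous[OF assms]]
  by (simp_all add: lborel_prod)

text \<open>Ladyzhenskaya's trick: bound one factor by a function of \<open>y\<close> alone and the
  other by a function of \<open>x\<close> alone, so that the double integral of the product splits.\<close>

lemma nn_integral_product_squares_le:
  assumes f: "test_fun \<Omega> f" and g: "test_fun \<Omega> g"
  shows "(\<integral>\<^sup>+p. ennreal ((f p)\<^sup>2 * (g p)\<^sup>2) \<partial>lborel)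
    \<le> (\<integral>\<^sup>+p. ennreal ((f p)\<^sup>2 + (pdx f p)\<^sup>2) \<partial>lborel) * (\<integral>\<^sup>+p. ennreal ((g p)\<^sup>2 + (pdy g p)\<^sup>2) \<partial>lborel)"
proof -
  note [measurable] = f[THEN test_fun_smooth, THEN smooth_borel_measurable(1)]
    g[THEN test_fun_smooth, THEN smooth_borel_measurable(1)]
    f[THEN test_fun_smooth, THEN smooth_pdx, THEN smooth_borel_measurable(1)]
    g[THEN test_fun_smooth, THEN smooth_pdy, THEN smooth_borel_measurable(1)]
    f[THEN test_fun_smooth, THEN smooth_borel_measurable(2)]
    g[THEN test_fun_smooth, THEN smooth_borel_measurable(2)]
    f[THEN test_fun_smooth, THEN smooth_pdx, THEN smooth_borel_measurable(2)]
    g[THEN test_fun_smooth, THEN smooth_pdy, THEN smooth_borel_measurable(2)]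
  define A where "A y = (\<integral>\<^sup>+t. ennreal ((f (t, y))\<^sup>2 + (pdx f (t, y))\<^sup>2) \<partial>lborel)" for y
  define B where "B x = (\<integral>\<^sup>+t. ennreal ((g (x, t))\<^sup>2 + (pdy g (x, t))\<^sup>2) \<partial>lborel)" for x
  have [measurable]: "A \<in> borel_measurable lborel" "B \<in> borel_measurable lborel"
    unfolding A_def B_def by measurable
  have "(\<integral>\<^sup>+p. ennreal ((f p)\<^sup>2 * (g p)\<^sup>2) \<partial>lborel)
    = (\<integral>\<^sup>+y. \<integral>\<^sup>+x. ennreal ((f (x, y))\<^sup>2 * (g (x, y))\<^sup>2) \<partial>lborel \<partial>lborel)"
    by (subst lborel_pair.nn_integral_snd) (simp_all add: lborel_prod)
  also have "\<dots> \<le> (\<integral>\<^sup>+y. \<integral>\<^sup>+x. A y * B x \<partial>lborel \<partial>lborel)"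
    unfolding A_def B_def
    by (intro nn_integral_mono, subst ennreal_mult)
       (simp_all only: zero_le zero_le_power2 mult_mono test_fun_square_le_slice_x[OF f] test_fun_square_le_slice_y[OF g])
  also have "\<dots> = (\<integral>\<^sup>+y. A y \<partial>lborel) * (\<integral>\<^sup>+x. B x \<partial>lborel)"
    by (simp add: nn_integral_cmult nn_integral_multc)
  also have "(\<integral>\<^sup>+y. A y \<partial>lborel) = (\<integral>\<^sup>+p. ennreal ((f p)\<^sup>2 + (pdx f p)\<^sup>2) \<partial>lborel)"
    unfolding A_def by (subst lborel_pair.nn_integral_snd) (simp_all add: lborel_prod)
  also have "(\<integral>\<^sup>+x. B x \<partial>lborel) = (\<integral>\<^sup>+p. ennreal ((g p)\<^sup>2 + (pdy g p)\<^sup>2) \<partial>lborel)"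
    unfolding B_def by (subst lborel.nn_integral_fst) (simp_all add: lborel_prod)
  finally show ?thesis .
qed

section \<open>The fundamental lemma of the calculus of variations\<close>

primrec n_differentiable :: "nat \<Rightarrow> (real \<Rightarrow> real) \<Rightarrow> bool" where
  "n_differentiable 0 f \<longleftrightarrow> True"
| "n_differentiable (Suc n) f \<longleftrightarrow> (\<forall>x. f differentiable (at x)) \<and> n_differentiable n (deriv f)"

lemma n_differentiable_SucI:
  assumes "\<And>x. (f has_real_derivative f' x) (at x)" "n_differentiable n f'"
  shows "n_differentiable (Suc n) f"
proof -
  have "deriv f = f'" using assms(1) by (intro ext DERIV_imp_deriv)
  then show ?thesis using assms by (auto simp: real_differentiable_def)
qed

lemma n_differentiable_DERIV:
  "n_differentiable (Suc n) f \<Longrightarrow> (f has_real_derivative deriv f x) (at x)"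
  by (simp add: DERIV_deriv_iff_real_differentiable)

lemma n_differentiable_pred: "n_differentiable (Suc n) f \<Longrightarrow> n_differentiable n f"
  by (induction n arbitrary: f) auto

lemma n_differentiable_add:
  "n_differentiable n f \<Longrightarrow> n_differentiable n g \<Longrightarrow> n_differentiable n (\<lambda>x. f x + g x)"
proof (induction n arbitrary: f g)
  case (Suc n)
  then show ?case
    by (intro n_differentiable_SucI[OF DERIV_add[OF n_differentiable_DERIV n_differentiable_DERIV]]) auto
qed simp

text \<open>Smoothness is split into finite orders for the sake of this induction: the product rule
  pairs a derivative, of order \<open>n\<close>, with an undifferentiated factor, whose order is
  lowered from \<open>Suc n\<close> to \<open>n\<close>.\<close>

lemma n_differentiable_mult:
  "n_differentiable n f \<Longrightarrow> n_differentiable n g \<Longrightarrow> n_differentiable n (\<lambda>x. f x * g x)"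
proof (induction n arbitrary: f g)
  case (Suc n)
  have "n_differentiable n (\<lambda>x. deriv f x * g x + deriv g x * f x)"
    using Suc n_differentiable_pred by (intro n_differentiable_add Suc.IH) auto
  with Suc.prems show ?case
    by (intro n_differentiable_SucI[OF DERIV_mult[OF n_differentiable_DERIV n_differentiable_DERIV]]) auto
qed simp

lemma n_differentiable_const: "n_differentiable n (\<lambda>x. c)"
  by (induction n arbitrary: c) auto

lemma n_differentiable_affine:
  "n_differentiable n f \<Longrightarrow> n_differentiable n (\<lambda>x. f (c * x + d))"
proof (induction n arbitrary: f)
  case (Suc n)
  have "((\<lambda>x. f (c * x + d)) has_real_derivative deriv f (c * x + d) * c) (at x)" for x
    by (rule DERIV_chain2[OF n_differentiable_DERIV[OF Suc.prems]]) (auto intro!: derivative_eq_intros)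
  moreover have "n_differentiable n (\<lambda>x. deriv f (c * x + d) * c)"
    using Suc by (intro n_differentiable_mult n_differentiable_const) auto
  ultimately show ?case by (rule n_differentiable_SucI)
qed simp

text \<open>For the polynomial 1 this is the classical flat function
  \<open>exp (- inverse t)\<close>, extended by zero. The polynomial parameter makes the family
  closed under differentiation.\<close>

definition poly_exp_inverse :: "real poly \<Rightarrow> real \<Rightarrow> real" where
  "poly_exp_inverse p t = (if t \<le> 0 then 0 else poly p (inverse t) * exp (- inverse t))"

lemma poly_times_exp_minus_tendsto_0: "((\<lambda>s. poly p s * exp (- s)) \<longlongrightarrow> (0::real)) at_top"
proof -
  have "((\<lambda>s. \<Sum>i\<le>degree p. coeff p i * (s ^ i / exp s)) \<longlongrightarrow> (\<Sum>i\<le>degree p. coeff p i * 0)) at_top"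
    by (intro tendsto_intros tendsto_power_div_exp_0)
  then show ?thesis
    by (simp add: poly_altdef exp_minus sum_distrib_right divide_inverse mult.assoc)
qed

text \<open>With \<open>s = inverse t\<close>, the chain rule multiplies the derivative of
  \<open>poly p s * exp (- s)\<close> in \<open>s\<close> by minus the square of \<open>s\<close>;
  this gives the new polynomial. At 0 exponential decay beats every polynomial, and the left side is
  constant.\<close>

lemma DERIV_poly_exp_inverse:
  "(poly_exp_inverse p has_real_derivative
     poly_exp_inverse (monom 1 2 * (p - pderiv p)) t) (at t)"
proof -
  consider "t < 0" | "t = 0" | "t > 0" by linarith
  then show ?thesis
  proof cases
    case 1
    have "((\<lambda>_. 0) has_real_derivative 0) (at t)" by simp
    moreover have "\<forall>\<^sub>F s in nhds t. poly_exp_inverse p s = 0"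
      using 1 by (intro eventually_nhds[THEN iffD2] exI[of _ "{..<0}"]) (auto simp: poly_exp_inverse_def)
    ultimately have "(poly_exp_inverse p has_real_derivative 0) (at t)"
      by (subst DERIV_cong_ev[OF refl _ refl]) auto
    then show ?thesis using 1 by (simp add: poly_exp_inverse_def)
  next
    case 2
    \<comment> \<open>Dividing by \<open>s\<close> multiplies the polynomial in
      \<open>inverse s\<close> by its variable, so the difference quotient is of the same
      type.\<close>
    have "((\<lambda>s. poly (pCons 0 p) (inverse s) * exp (- inverse s)) \<longlongrightarrow> 0) (at_right 0)"
      by (rule filterlim_compose[OF poly_times_exp_minus_tendsto_0 filterlim_inverse_at_top_right])
    then have "((\<lambda>s. poly_exp_inverse p s / s) \<longlongrightarrow> 0) (at_right 0)"
      by (rule Lim_transform_eventually)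
         (auto simp: poly_exp_inverse_def eventually_at_filter divide_inverse)
    moreover have "((\<lambda>s. poly_exp_inverse p s / s) \<longlongrightarrow> 0) (at_left 0)"
      by (rule Lim_transform_eventually[OF tendsto_const])
         (auto simp: poly_exp_inverse_def eventually_at_filter)
    ultimately have "((\<lambda>s. poly_exp_inverse p s / s) \<longlongrightarrow> 0) (at 0)"
      by (simp add: filterlim_split_at)
    then show ?thesis using 2 by (simp add: has_field_derivative_iff poly_exp_inverse_def)
  next
    case 3
    have "((\<lambda>s. poly p (inverse s) * exp (- inverse s)) has_real_derivative
      poly_exp_inverse (monom 1 2 * (p - pderiv p)) t) (at t)"
      using 3 by (auto intro!: derivative_eq_intros simp: poly_exp_inverse_def poly_monom algebra_simps power2_eq_square)
    moreover have "\<forall>\<^sub>F s in nhds t. poly_exp_inverse p s = poly p (inverse s) * exp (- inverse s)"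
      using 3 by (intro eventually_nhds[THEN iffD2] exI[of _ "{0<..}"]) (auto simp: poly_exp_inverse_def)
    ultimately show ?thesis
      by (subst DERIV_cong_ev[OF refl _ refl]) auto
  qed
qed

lemma n_differentiable_poly_exp_inverse: "n_differentiable n (poly_exp_inverse p)"
proof (induction n arbitrary: p)
  case (Suc n)
  show ?case by (rule n_differentiable_SucI[OF DERIV_poly_exp_inverse Suc])
qed simp

text \<open>One flat function rises after \<open>a\<close>, its mirror image falls before
  \<open>b\<close>. Raising \<open>k\<close> steepens both flanks without moving the support, so one
  compact box serves the whole sequence, and the limit is the indicator of the open
  interval.\<close>

definition plateau :: "real \<Rightarrow> real \<Rightarrow> nat \<Rightarrow> real \<Rightarrow> real" where
  "plateau a b k t = poly_exp_inverse 1 (real (Suc k) * t + - real (Suc k) * a)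
     * poly_exp_inverse 1 (- real (Suc k) * t + real (Suc k) * b)"

lemma n_differentiable_plateau: "n_differentiable n (plateau a b k)"
  unfolding plateau_def[abs_def]
  by (intro n_differentiable_mult n_differentiable_affine n_differentiable_poly_exp_inverse)

lemma plateau_eq:
  "plateau a b k t = (if a < t \<and> t < b
     then exp (- inverse (real (Suc k) * (t - a))) * exp (- inverse (real (Suc k) * (b - t))) else 0)"
proof -
  have "real (Suc k) * t + - real (Suc k) * a = real (Suc k) * (t - a)"
    "- real (Suc k) * t + real (Suc k) * b = real (Suc k) * (b - t)"
    by (simp_all add: algebra_simps)
  moreover have "real (Suc k) * s \<le> 0 \<longleftrightarrow> s \<le> 0" for s
    by (simp add: mult_le_0_iff)
  ultimately show ?thesis by (auto simp: plateau_def poly_exp_inverse_def)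
qed

lemma plateau_bounds: "0 \<le> plateau a b k t" "plateau a b k t \<le> 1"
  by (auto simp: plateau_eq intro!: mult_le_one)

lemma plateau_tendsto: "(\<lambda>k. plateau a b k t) \<longlonglongrightarrow> indicator {a<..<b} t"
proof (cases "a < t \<and> t < b")
  case True
  have *: "(\<lambda>k. exp (- inverse (real (Suc k) * s))) \<longlonglongrightarrow> 1" for s
  proof -
    have "(\<lambda>k. exp (- (inverse (real (Suc k)) * inverse s))) \<longlonglongrightarrow> exp (- (0 * inverse s))"
      by (intro tendsto_intros LIMSEQ_inverse_real_of_nat)
    then show ?thesis by simp
  qed
  have "(\<lambda>k. exp (- inverse (real (Suc k) * (t - a))) * exp (- inverse (real (Suc k) * (b - t)))) \<longlonglongrightarrow> 1 * 1"
    by (intro tendsto_mult *)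
  then show ?thesis using True by (simp add: plateau_eq)
qed (auto simp: plateau_eq)

section \<open>Tensor products as test functions\<close>

definition tensor :: "(real \<Rightarrow> real) \<Rightarrow> (real \<Rightarrow> real) \<Rightarrow> R2 \<Rightarrow> real" where
  "tensor \<alpha> \<beta> p = \<alpha> (fst p) * \<beta> (snd p)"

lemma pdx_tensor:
  assumes "\<And>t. \<alpha> differentiable (at t)"
  shows "pdx (tensor \<alpha> \<beta>) = tensor (deriv \<alpha>) \<beta>"
proof
  fix p
  have "((\<lambda>t. \<alpha> t * \<beta> (snd p)) has_real_derivative deriv \<alpha> (fst p) * \<beta> (snd p)) (at (fst p))"
    using assms by (intro DERIV_cmult_right) (simp add: DERIV_deriv_iff_real_differentiable)
  then show "pdx (tensor \<alpha> \<beta>) p = tensor (deriv \<alpha>) \<beta> p"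
    by (simp add: pdx_def tensor_def DERIV_imp_deriv)
qed

lemma pdy_tensor:
  assumes "\<And>t. \<beta> differentiable (at t)"
  shows "pdy (tensor \<alpha> \<beta>) = tensor \<alpha> (deriv \<beta>)"
proof
  fix p
  have "((\<lambda>t. \<alpha> (fst p) * \<beta> t) has_real_derivative \<alpha> (fst p) * deriv \<beta> (snd p)) (at (snd p))"
    using assms by (intro DERIV_cmult) (simp add: DERIV_deriv_iff_real_differentiable)
  then show "pdy (tensor \<alpha> \<beta>) p = tensor \<alpha> (deriv \<beta>) p"
    by (simp add: pdy_def tensor_def DERIV_imp_deriv)
qed

lemma differentiable_tensor:
  assumes "\<And>t. \<alpha> differentiable (at t)" "\<And>t. \<beta> differentiable (at t)"
  shows "tensor \<alpha> \<beta> differentiable (at p)"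
proof -
  have "(\<alpha> \<circ> fst) differentiable (at p)" "(\<beta> \<circ> snd) differentiable (at p)"
    by (intro differentiable_chain_at assms bounded_linear_imp_differentiable bounded_linear_fst
        bounded_linear_snd)+
  then show ?thesis
    using differentiable_mult[of "\<alpha> \<circ> fst" p UNIV "\<beta> \<circ> snd"] by (simp add: tensor_def[abs_def] o_def)
qed

text \<open>Each partial derivative replaces one factor by its derivative. Only this shape has to
  survive the induction over words, hence the unspecified factors.\<close>

lemma pdw_tensor:
  assumes "\<And>n. n_differentiable n \<alpha>" "\<And>n. n_differentiable n \<beta>"
  shows "\<exists>\<gamma> \<delta>. (\<forall>n. n_differentiable n \<gamma>) \<and> (\<forall>n. n_differentiable n \<delta>) \<and> pdw w (tensor \<alpha> \<beta>) = tensor \<gamma> \<delta>"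
proof (induction w)
  case Nil
  then show ?case using assms by auto
next
  case (Cons b w)
  then obtain \<gamma> \<delta> where *: "\<And>n. n_differentiable n \<gamma>" "\<And>n. n_differentiable n \<delta>"
    "pdw w (tensor \<alpha> \<beta>) = tensor \<gamma> \<delta>" by blast
  have "pdw (b # w) (tensor \<alpha> \<beta>) = (if b then tensor (deriv \<gamma>) \<delta> else tensor \<gamma> (deriv \<delta>))"
    using *(1,2)[of "Suc 0"] by (simp add: *(3) pdx_tensor pdy_tensor)
  moreover have "\<forall>n. n_differentiable n (deriv \<gamma>)" "\<forall>n. n_differentiable n (deriv \<delta>)"
    using *(1,2)[of "Suc _"] by simp_all
  ultimately show ?case using *(1,2) by (cases b) auto
qed

lemma smooth_tensor:
  assumes "\<And>n. n_differentiable n \<alpha>" "\<And>n. n_differentiable n \<beta>"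
  shows "smooth (tensor \<alpha> \<beta>)"
proof -
  have "pdw w (tensor \<alpha> \<beta>) differentiable (at p)" for w p
  proof -
    obtain \<gamma> \<delta> where *: "\<And>n. n_differentiable n \<gamma>" "\<And>n. n_differentiable n \<delta>"
      "pdw w (tensor \<alpha> \<beta>) = tensor \<gamma> \<delta>" using pdw_tensor[OF assms] by blast
    then show ?thesis
      using *(1)[of "Suc 0"] *(2)[of "Suc 0"] unfolding *(3) n_differentiable.simps
      by (intro differentiable_tensor) blast+
  qed
  then show ?thesis
    unfolding smooth_def
    by (auto simp: continuous_on_eq_continuous_at intro: differentiable_imp_continuous_within)
qed

text \<open>For tensor products mixed partial derivatives commute trivially; since they already suffice as
  test functions, no general symmetry theorem for second derivatives is needed.\<close>

lemma pd_commute_tensor: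
  assumes "\<And>n. n_differentiable n \<alpha>" "\<And>n. n_differentiable n \<beta>"
  shows "pdx (pdy (tensor \<alpha> \<beta>)) = pdy (pdx (tensor \<alpha> \<beta>))"
  using assms[of "Suc 0"] by (simp add: pdx_tensor pdy_tensor)

text \<open>The positive and the negative part of \<open>f\<close>, taken as densities, give
  measures that agree on boxes. Boxes form an intersection-stable generator with a finite
  exhaustion, so the measures and then the densities coincide; equal positive and negative parts are
  both zero.\<close>

lemma AE_zero_if_box_integrals_zero:
  fixes f :: "'a::euclidean_space \<Rightarrow> real"
  assumes f: "integrable lborel f"
    and 0: "\<And>a b. (\<integral>x. indicator (box a b) x * f x \<partial>lborel) = 0"
  shows "AE x in lborel. f x = 0"
proof -
  have [measurable]: "f \<in> borel_measurable borel" using f by auto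
  let ?P = "density lborel (\<lambda>x. ennreal (max 0 (f x)))"
  let ?N = "density lborel (\<lambda>x. ennreal (max 0 (- f x)))"
  let ?E = "range (\<lambda>(a, b). box a b :: 'a set)"
  have int: "integrable lborel (\<lambda>x. max 0 (f x) * indicator (box a b) x)"
    "integrable lborel (\<lambda>x. max 0 (- f x) * indicator (box a b) x)" for a b
    using f by (auto intro!: integrable_real_mult_indicator integrable_max)
  have em: "emeasure ?P (box a b) = ennreal (\<integral>x. max 0 (f x) * indicator (box a b) x \<partial>lborel)"
    "emeasure ?N (box a b) = ennreal (\<integral>x. max 0 (- f x) * indicator (box a b) x \<partial>lborel)" for a b
    using nn_integral_eq_integral[OF int(1)[of a b]] nn_integral_eq_integral[OF int(2)[of a b]]
    by (simp_all add: emeasure_density ennreal_mult'' ennreal_indicator)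
  have "?P = ?N"
  proof (rule measure_eqI_generator_eq)
    show "Int_stable ?E"
      by (auto simp: Int_stable_def box_Int_box)
    show "?E \<subseteq> Pow UNIV" "sets ?P = sigma_sets UNIV ?E" "sets ?N = sigma_sets UNIV ?E"
      by (simp_all add: borel_eq_box)
    let ?A = "\<lambda>n::nat. box (- (real n *\<^sub>R One)) (real n *\<^sub>R One) :: 'a set"
    show "range ?A \<subseteq> ?E" "(\<Union>i. ?A i) = UNIV"
      unfolding UN_box_eq_UNIV by auto
    show "emeasure ?P (?A i) \<noteq> \<infinity>" for i by (simp add: em)
    show "emeasure ?P X = emeasure ?N X" if "X \<in> ?E" for X
    proof -
      obtain a b where X: "X = box a b" using \<open>X \<in> ?E\<close> by auto
      have "(\<integral>x. max 0 (f x) * indicator (box a b) x \<partial>lborel)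
        - (\<integral>x. max 0 (- f x) * indicator (box a b) x \<partial>lborel)
        = (\<integral>x. indicator (box a b) x * f x \<partial>lborel)"
        by (subst Bochner_Integration.integral_diff[symmetric, OF int])
           (auto intro!: Bochner_Integration.integral_cong simp: indicator_def max_def)
      then show ?thesis unfolding X em 0 by simp
    qed
  qed
  then have "AE x in lborel. ennreal (max 0 (f x)) = ennreal (max 0 (- f x))"
    by (intro sigma_finite_measure.density_unique[OF sigma_finite_lborel]) auto
  then show ?thesis
    by eventually_elim (simp add: max_def split: if_splits)
qed

section \<open>Localisation to boxes inside the domain\<close>

lemma box_R2: "box a b = {fst a<..<fst b} \<times> {snd a<..<snd (b::R2)}"
  by (cases a; cases b) (auto simp: box_def Basis_prod_def)

lemma cbox_R2: "cbox a b = {fst a..fst b} \<times> {snd a..snd (b::R2)}"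
  by (cases a; cases b) (simp add: cbox_Pair_eq)

lemma test_fun_plateau:
  assumes "cbox a b \<subseteq> \<Omega>"
  shows "test_fun \<Omega> (tensor (plateau (fst a) (fst b) k) (plateau (snd a) (snd b) k))"
  unfolding test_fun_iff_compact
proof (intro conjI exI)
  show "smooth (tensor (plateau (fst a) (fst b) k) (plateau (snd a) (snd b) k))"
    by (intro smooth_tensor n_differentiable_plateau)
  show "compact (cbox a b)" by simp
  show "cbox a b \<subseteq> \<Omega>" by fact
  show "\<forall>p. p \<notin> cbox a b \<longrightarrow> tensor (plateau (fst a) (fst b) k) (plateau (snd a) (snd b) k) p = 0"
    by (auto simp: tensor_def cbox_R2 plateau_eq)
qed

text \<open>Asking for vanishing against tensor products only is what makes the lemma usable for
  symmetry of second derivatives, where commutation is available just for them. Plateau products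
  approximate box indicators, with \<bar>F\<bar> as dominating function.\<close>

lemma fundamental_lemma:
  assumes \<Omega>: "open \<Omega>" and f: "integrable (restrict_space lborel \<Omega>) f"
    and 0: "\<And>\<alpha> \<beta>. \<lbrakk>\<And>n. n_differentiable n \<alpha>; \<And>n. n_differentiable n \<beta>; test_fun \<Omega> (tensor \<alpha> \<beta>)\<rbrakk>
      \<Longrightarrow> (\<integral>p. f p * tensor \<alpha> \<beta> p \<partial>restrict_space lborel \<Omega>) = 0"
  shows "AE p in restrict_space lborel \<Omega>. f p = 0"
proof -
  have [simp]: "\<Omega> \<in> sets borel" using \<Omega> by simp
  define F where "F p = indicator \<Omega> p * f p" for p
  have F: "integrable lborel F"
    using f by (simp add: integrable_restrict_space F_def[abs_def])
  have [measurable]: "F \<in> borel_measurable borel" using F by auto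
  have box0: "(\<integral>p. indicator (box a b) p * F p \<partial>lborel) = 0" if ab: "cbox a b \<subseteq> \<Omega>" for a b
  proof -
    define \<phi> where "\<phi> k = tensor (plateau (fst a) (fst b) k) (plateau (snd a) (snd b) k)" for k
    have [measurable]: "\<phi> k \<in> borel_measurable borel" for k
      unfolding \<phi>_def by (rule smooth_borel_measurable[OF test_fun_smooth[OF test_fun_plateau[OF ab]]])
    have "(\<lambda>k. \<integral>p. \<phi> k p * F p \<partial>lborel) \<longlonglongrightarrow> (\<integral>p. indicator (box a b) p * F p \<partial>lborel)"
    proof (rule integral_dominated_convergence[where w = "\<lambda>p. \<bar>F p\<bar>"])
      show "AE p in lborel. (\<lambda>k. \<phi> k p * F p) \<longlonglongrightarrow> indicator (box a b) p * F p"
      proof (rule AE_I2)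
        fix p
        have "(\<lambda>k. \<phi> k p) \<longlonglongrightarrow> indicator {fst a<..<fst b} (fst p) * indicator {snd a<..<snd b} (snd p)"
          unfolding \<phi>_def tensor_def by (intro tendsto_mult plateau_tendsto)
        then show "(\<lambda>k. \<phi> k p * F p) \<longlonglongrightarrow> indicator (box a b) p * F p"
          by (intro tendsto_mult tendsto_const) (simp add: box_R2 indicator_times)
      qed
      show "AE p in lborel. norm (\<phi> k p * F p) \<le> \<bar>F p\<bar>" for k
        unfolding \<phi>_def tensor_def
        by (intro AE_I2) (auto simp: abs_mult plateau_bounds intro!: mult_left_le_one_le mult_le_one)
    qed (use F in auto)
    moreover have "(\<integral>p. \<phi> k p * F p \<partial>lborel) = 0" for k
      using 0[OF n_differentiable_plateau n_differentiable_plateau test_fun_plateau[OF ab], of k]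
      by (simp add: integral_restrict_space F_def \<phi>_def ac_simps)
    ultimately show ?thesis by (simp add: LIMSEQ_const_iff)
  qed
  \<comment> \<open>The box criterion wants integrals over all boxes, whereas \<open>box0\<close>
    covers those whose closure lies in \<Omega>; so it is applied to \<open>F\<close> cut off to one
    such box.\<close>
  have Q: "AE p in lborel. p \<in> box c d \<longrightarrow> F p = 0" if cd: "cbox c d \<subseteq> \<Omega>" for c d
  proof -
    have "AE p in lborel. indicator (box c d) p * F p = 0"
    proof (rule AE_zero_if_box_integrals_zero)
      show "integrable lborel (\<lambda>p. indicator (box c d) p * F p)"
        using integrable_real_mult_indicator[OF _ F, of "box c d"] by (simp add: mult.commute)
      fix a b :: R2
      \<comment> \<open>Corners of the intersection of the two boxes, which is again a box with
        closure in \<Omega>, possibly empty.\<close>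
      define u v where "u = (max (fst a) (fst c), max (snd a) (snd c))"
        and "v = (min (fst b) (fst d), min (snd b) (snd d))"
      have "cbox u v \<subseteq> cbox c d" by (auto simp: cbox_R2 u_def v_def)
      moreover have "indicator (box a b) p * indicator (box c d) p = (indicator (box u v) p :: real)" for p
        by (auto simp: box_R2 u_def v_def indicator_def)
      ultimately show "(\<integral>p. indicator (box a b) p * (indicator (box c d) p * F p) \<partial>lborel) = 0"
        using box0[of u v] cd by (simp add: mult.assoc[symmetric])
    qed
    then show ?thesis by eventually_elim (auto simp: indicator_def)
  qed
  \<comment> \<open>Null sets may be united only countably often, so the cover of \<Omega> is
    thinned out by Lindelof.\<close>
  define \<F> where "\<F> = {box c d | c d :: R2. cbox c d \<subseteq> \<Omega>}"
  obtain \<G> where \<G>: "\<G> \<subseteq> \<F>" "countable \<G>" "\<Union>\<G> = \<Union>\<F>"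
    using Lindelof[of \<F>] by (auto simp: \<F>_def)
  have "AE p in lborel. \<forall>B\<in>\<G>. p \<in> B \<longrightarrow> F p = 0"
    using \<G>(1,2) Q by (subst AE_ball_countable) (auto simp: \<F>_def)
  moreover have "\<exists>B\<in>\<G>. p \<in> B" if "p \<in> \<Omega>" for p
  proof -
    obtain c d where "p \<in> box c d" "cbox c d \<subseteq> \<Omega>"
      using open_contains_cbox[OF \<Omega> \<open>p \<in> \<Omega>\<close>] by metis
    then have "p \<in> \<Union>\<F>" unfolding \<F>_def by blast
    then show ?thesis using \<G>(3) by blast
  qed
  ultimately have "AE p in lborel. p \<in> \<Omega> \<longrightarrow> f p = 0"
    by (auto simp: F_def elim!: eventually_mono)
  then show ?thesis by (simp add: AE_restrict_space_iff)
qed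

section \<open>Weak derivatives and the space H20\<close>

locale bounded_open =
  fixes \<Omega> :: "R2 set"
  assumes open_domain: "open \<Omega>" and bounded_domain: "bounded \<Omega>"
begin

abbreviation M :: "R2 measure" where "M \<equiv> restrict_space lborel \<Omega>"

lemma sets_domain [simp, measurable]: "\<Omega> \<in> sets borel"
  using open_domain by simp

text \<open>Boundedness enters here: on a finite measure L2 functions are integrable, as the
  variational lemma demands.\<close>

lemma finite_measure_M: "finite_measure M"
proof
  have "emeasure lborel \<Omega> < \<infinity>"
    using emeasure_bounded_finite[OF bounded_domain] by simp
  then show "emeasure M (space M) \<noteq> \<infinity>"
    by (simp add: emeasure_restrict_space space_restrict_space)
qed

lemma set_lebesgue_integral_M: "(LINT p:\<Omega>|lborel. f p) = (\<integral>p. (f p :: real) \<partial>M)"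
  by (simp add: set_lebesgue_integral_def integral_restrict_space)

text \<open>Bridge from the set integrals of the definitions to a plain measure, for which the
  Hilbert space facts are stated.\<close>

lemma L2_iff_square_integrable: "L2 \<Omega> g \<longleftrightarrow> square_integrable M g"
  by (simp add: L2_def square_integrable_def set_borel_measurable_def set_integrable_def
      borel_measurable_restrict_space_iff integrable_restrict_space)

lemma integral_M_eq:
  assumes "\<And>p. p \<notin> \<Omega> \<Longrightarrow> f p = 0"
  shows "(\<integral>p. (f p :: real) \<partial>M) = (\<integral>p. f p \<partial>lborel)"
  unfolding integral_restrict_space[of \<Omega> lborel, simplified]
  using assms by (intro Bochner_Integration.integral_cong) (auto simp: indicator_def)

lemma test_fun_zero: "test_fun \<Omega> \<phi> \<Longrightarrow> p \<notin> \<Omega> \<Longrightarrow> \<phi> p = 0"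
  unfolding test_fun_iff_compact by blast

lemma smooth_borel_measurable_M: "smooth f \<Longrightarrow> f \<in> borel_measurable M"
  using smooth_borel_measurable(2) by (intro measurable_restrict_space1) simp

lemma test_fun_borel_measurable_M: "test_fun \<Omega> f \<Longrightarrow> f \<in> borel_measurable M"
  by (rule smooth_borel_measurable_M[OF test_fun_smooth])

lemma test_fun_integrable_M:
  assumes "test_fun \<Omega> f" "smooth g"
  shows "integrable M (\<lambda>p. f p * g p)"
proof -
  have "(\<lambda>p. indicator \<Omega> p *\<^sub>R (f p * g p)) = (\<lambda>p. f p * g p)"
    using test_fun_zero[OF assms(1)] by (auto simp: indicator_def fun_eq_iff)
  then show ?thesis
    using test_fun_integrable_mult[OF assms] by (simp add: integrable_restrict_space)
qed

lemma test_fun_square_integrable: "test_fun \<Omega> f \<Longrightarrow> square_integrable M f"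
  using test_fun_integrable_M[of f f] smooth_borel_measurable_M[of f]
  by (simp add: square_integrable_def power2_eq_square test_fun_smooth)

lemma by_parts_x:
  assumes "test_fun \<Omega> f" "smooth g"
  shows "(\<integral>p. f p * pdx g p \<partial>M) = - (\<integral>p. pdx f p * g p \<partial>M)"
  using test_fun_by_parts_x[OF assms] assms(1)
  by (simp add: integral_M_eq test_fun_zero test_fun_pdx)

lemma by_parts_y:
  assumes "test_fun \<Omega> f" "smooth g"
  shows "(\<integral>p. f p * pdy g p \<partial>M) = - (\<integral>p. pdy f p * g p \<partial>M)"
  using test_fun_by_parts_y[OF assms] assms(1)
  by (simp add: integral_M_eq test_fun_zero test_fun_pdy)

section \<open>Symmetry of second derivatives and uniqueness of weak ones\<close>

lemma AE_eq_if_test_integrals_eq: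
  assumes "square_integrable M g" "square_integrable M h"
    and eq: "\<And>\<alpha> \<beta>. \<lbrakk>\<And>n. n_differentiable n \<alpha>; \<And>n. n_differentiable n \<beta>; test_fun \<Omega> (tensor \<alpha> \<beta>)\<rbrakk>
      \<Longrightarrow> (\<integral>p. g p * tensor \<alpha> \<beta> p \<partial>M) = (\<integral>p. h p * tensor \<alpha> \<beta> p \<partial>M)"
  shows "AE p in M. g p = h p"
proof -
  have "AE p in M. g p - h p = 0"
  proof (rule fundamental_lemma[OF open_domain])
    show "integrable M (\<lambda>p. g p - h p)"
      by (intro square_integrable_integrable finite_measure_M square_integrable_diff assms)
    fix \<alpha> \<beta> assume *: "\<And>n. n_differentiable n \<alpha>" "\<And>n. n_differentiable n \<beta>" "test_fun \<Omega> (tensor \<alpha> \<beta>)"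
    have "integrable M (\<lambda>p. g p * tensor \<alpha> \<beta> p)" "integrable M (\<lambda>p. h p * tensor \<alpha> \<beta> p)"
      by (intro square_integrable_mult assms test_fun_square_integrable *(3))+
    then show "(\<integral>p. (g p - h p) * tensor \<alpha> \<beta> p \<partial>M) = 0"
      using eq[OF *] by (simp add: left_diff_distrib)
  qed
  then show ?thesis by eventually_elim simp
qed

text \<open>Both derivatives are moved onto a tensor product, exchanged there, and moved back.
  Equality almost everywhere suffices, because it is used under integrals only.\<close>

lemma pd_commute_AE:
  assumes \<phi>: "test_fun \<Omega> \<phi>"
  shows "AE p in M. pdx (pdy \<phi>) p = pdy (pdx \<phi>) p"
proof (rule AE_eq_if_test_integrals_eq)
  show "square_integrable M (pdx (pdy \<phi>))" "square_integrable M (pdy (pdx \<phi>))"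
    using \<phi> by (auto intro!: test_fun_square_integrable test_fun_pdx test_fun_pdy)
  fix \<alpha> \<beta> assume *: "\<And>n. n_differentiable n \<alpha>" "\<And>n. n_differentiable n \<beta>" "test_fun \<Omega> (tensor \<alpha> \<beta>)"
  let ?t = "tensor \<alpha> \<beta>"
  have s: "smooth ?t" by (rule test_fun_smooth[OF *(3)])
  have "(\<integral>p. pdx (pdy \<phi>) p * ?t p \<partial>M) = - (\<integral>p. pdy \<phi> p * pdx ?t p \<partial>M)"
    using by_parts_x[OF test_fun_pdy[OF \<phi>] s] by simp
  also have "\<dots> = (\<integral>p. \<phi> p * pdy (pdx ?t) p \<partial>M)"
    using by_parts_y[OF \<phi> smooth_pdx[OF s]] by simp
  also have "\<dots> = (\<integral>p. \<phi> p * pdx (pdy ?t) p \<partial>M)"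
    by (simp only: pd_commute_tensor[OF *(1,2)])
  also have "\<dots> = - (\<integral>p. pdx \<phi> p * pdy ?t p \<partial>M)"
    using by_parts_x[OF \<phi> smooth_pdy[OF s]] by simp
  also have "\<dots> = (\<integral>p. pdy (pdx \<phi>) p * ?t p \<partial>M)"
    using by_parts_y[OF test_fun_pdx[OF \<phi>] s] by simp
  finally show "(\<integral>p. pdx (pdy \<phi>) p * ?t p \<partial>M) = (\<integral>p. pdy (pdx \<phi>) p * ?t p \<partial>M)" .
qed

lemma weak_deriv_M:
  "weak_deriv \<Omega> i j u g \<longleftrightarrow> (\<forall>\<phi>. test_fun \<Omega> \<phi> \<longrightarrow>
     (\<integral>p. u p * pd i j \<phi> p \<partial>M) = (-1) ^ (i + j) * (\<integral>p. g p * \<phi> p \<partial>M))"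
  by (simp add: weak_deriv_def set_lebesgue_integral_M)

lemma weak_deriv_unique:
  assumes "square_integrable M g" "square_integrable M h" "weak_deriv \<Omega> i j u g" "weak_deriv \<Omega> i j u h"
  shows "AE p in M. g p = h p"
proof (rule AE_eq_if_test_integrals_eq[OF assms(1,2)])
  fix \<alpha> \<beta> assume "test_fun \<Omega> (tensor \<alpha> \<beta>)"
  then have "(\<integral>p. u p * pd i j (tensor \<alpha> \<beta>) p \<partial>M) = (-1) ^ (i + j) * (\<integral>p. g p * tensor \<alpha> \<beta> p \<partial>M)"
    "(\<integral>p. u p * pd i j (tensor \<alpha> \<beta>) p \<partial>M) = (-1) ^ (i + j) * (\<integral>p. h p * tensor \<alpha> \<beta> p \<partial>M)"
    using assms(3,4) unfolding weak_deriv_M by blast+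
  then show "(\<integral>p. g p * tensor \<alpha> \<beta> p \<partial>M) = (\<integral>p. h p * tensor \<alpha> \<beta> p \<partial>M)" by simp
qed

lemma order_le_2_cases:
  assumes "i + j \<le> (2::nat)"
  obtains "i = 0" "j = 0" | "i = 1" "j = 0" | "i = 0" "j = 1" | "i = 2" "j = 0" | "i = 1" "j = 1"
    | "i = 0" "j = 2"
proof -
  consider "i = 0" | "i = 1" | "i = 2" using assms by linarith
  then show thesis
  proof cases
    case 1
    consider "j = 0" | "j = 1" | "j = 2" using 1 assms by linarith
    then show thesis using 1 that by cases blast+
  next
    case 2
    consider "j = 0" | "j = 1" using 2 assms by linarith
    then show thesis using 2 that by cases blast+
  next
    case 3
    then show thesis using assms that by simp
  qed
qed

lemma weak_deriv_test_fun:
  assumes \<phi>: "test_fun \<Omega> \<phi>" and ij: "i + j \<le> 2"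
  shows "weak_deriv \<Omega> i j \<phi> (pd i j \<phi>)"
  unfolding weak_deriv_M
proof (intro allI impI)
  fix \<theta> assume \<theta>: "test_fun \<Omega> \<theta>"
  note s = test_fun_smooth[OF \<theta>]
  \<comment> \<open>Moving \<open>pdx\<close> and then \<open>pdy\<close> off \<theta> reverses
    their order on \<phi>, while \<open>pd 1 1\<close> has \<open>pdx\<close> outermost.\<close>
  have mixed: "(\<integral>p. pdy (pdx \<phi>) p * \<theta> p \<partial>M) = (\<integral>p. pdx (pdy \<phi>) p * \<theta> p \<partial>M)"
    using pd_commute_AE[OF \<phi>] \<phi> \<theta>
    by (intro integral_cong_AE borel_measurable_times test_fun_borel_measurable_M)
       (auto intro: test_fun_pdx test_fun_pdy)
  from ij show "(\<integral>p. \<phi> p * pd i j \<theta> p \<partial>M) = (-1) ^ (i + j) * (\<integral>p. pd i j \<phi> p * \<theta> p \<partial>M)"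
    by (cases rule: order_le_2_cases)
       (simp_all add: pd_simps mixed by_parts_x by_parts_y \<phi> s smooth_pdx smooth_pdy test_fun_pdx test_fun_pdy)
qed

section \<open>Linearity of the chosen weak derivatives\<close>

lemma weak_deriv_add:
  assumes "square_integrable M u" "square_integrable M v" "square_integrable M g" "square_integrable M h"
    and "weak_deriv \<Omega> i j u g" "weak_deriv \<Omega> i j v h"
  shows "weak_deriv \<Omega> i j (\<lambda>p. u p + v p) (\<lambda>p. g p + h p)"
  unfolding weak_deriv_M
proof (intro allI impI)
  fix \<phi> assume \<phi>: "test_fun \<Omega> \<phi>"
  have "integrable M (\<lambda>p. u p * pd i j \<phi> p)" "integrable M (\<lambda>p. v p * pd i j \<phi> p)"
    "integrable M (\<lambda>p. g p * \<phi> p)" "integrable M (\<lambda>p. h p * \<phi> p)"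
    using \<phi> by (auto intro!: square_integrable_mult assms test_fun_square_integrable test_fun_pd)
  then show "(\<integral>p. (u p + v p) * pd i j \<phi> p \<partial>M) = (-1) ^ (i + j) * (\<integral>p. (g p + h p) * \<phi> p \<partial>M)"
    using assms(5,6) \<phi> by (simp add: weak_deriv_M distrib_right distrib_left)
qed

lemma weak_deriv_cmult:
  assumes "weak_deriv \<Omega> i j u g"
  shows "weak_deriv \<Omega> i j (\<lambda>p. c * u p) (\<lambda>p. c * g p)"
  using assms unfolding weak_deriv_M by (simp add: mult.assoc)

lemma H2_square_integrable: "H2 \<Omega> u \<Longrightarrow> square_integrable M u"
  by (simp add: H2_def L2_iff_square_integrable)

text \<open>A single candidate does two things: it shows that the choice in \<open>wd\<close> has
  something to choose from, and by uniqueness it identifies the result.\<close>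

lemma wd_eqI:
  assumes "square_integrable M g" "weak_deriv \<Omega> i j u g"
  shows "square_integrable M (wd \<Omega> i j u)" "weak_deriv \<Omega> i j u (wd \<Omega> i j u)"
    "AE p in M. wd \<Omega> i j u p = g p"
proof -
  have "square_integrable M (wd \<Omega> i j u) \<and> weak_deriv \<Omega> i j u (wd \<Omega> i j u)"
    using someI_ex[of "\<lambda>g. square_integrable M g \<and> weak_deriv \<Omega> i j u g"] assms
    unfolding wd_def L2_iff_square_integrable by blast
  then show "square_integrable M (wd \<Omega> i j u)" "weak_deriv \<Omega> i j u (wd \<Omega> i j u)"
    "AE p in M. wd \<Omega> i j u p = g p"
    using assms weak_deriv_unique by blast+
qed

lemma H2_wd:
  assumes "H2 \<Omega> u" "i + j \<le> 2"
  shows "square_integrable M (wd \<Omega> i j u)" "weak_deriv \<Omega> i j u (wd \<Omega> i j u)"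
  using assms wd_eqI unfolding H2_def L2_iff_square_integrable by blast+

text \<open>Even the derivative of order zero is a choice. It has to be traded for the function
  itself where \<open>a2\<close> contains its second argument undifferentiated.\<close>

lemma wd_0_0: "H2 \<Omega> u \<Longrightarrow> AE p in M. wd \<Omega> 0 0 u p = u p"
  by (intro wd_eqI H2_square_integrable) (simp_all add: weak_deriv_M pd_simps)

lemma test_fun_wd:
  assumes "test_fun \<Omega> \<phi>" "i + j \<le> 2"
  shows "AE p in M. wd \<Omega> i j \<phi> p = pd i j \<phi> p"
  using assms by (intro wd_eqI weak_deriv_test_fun test_fun_square_integrable test_fun_pd)

lemma H2_test_fun: "test_fun \<Omega> \<phi> \<Longrightarrow> H2 \<Omega> \<phi>"
  unfolding H2_def L2_iff_square_integrable
  using weak_deriv_test_fun test_fun_square_integrable test_fun_pd by blast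

lemma
  assumes u: "H2 \<Omega> u" and v: "H2 \<Omega> v"
  shows H2_add: "H2 \<Omega> (\<lambda>p. u p + v p)"
    and wd_add: "i + j \<le> 2 \<Longrightarrow> AE p in M. wd \<Omega> i j (\<lambda>p. u p + v p) p = wd \<Omega> i j u p + wd \<Omega> i j v p"
proof -
  note s = u[THEN H2_square_integrable] v[THEN H2_square_integrable]
  have *: "square_integrable M (\<lambda>p. wd \<Omega> i j u p + wd \<Omega> i j v p)"
    "weak_deriv \<Omega> i j (\<lambda>p. u p + v p) (\<lambda>p. wd \<Omega> i j u p + wd \<Omega> i j v p)"
    if "i + j \<le> 2" for i j
    using that by (auto intro!: weak_deriv_add square_integrable_add s H2_wd u v)
  then show "H2 \<Omega> (\<lambda>p. u p + v p)"
    unfolding H2_def L2_iff_square_integrable using square_integrable_add[OF s] by blast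
  show "AE p in M. wd \<Omega> i j (\<lambda>p. u p + v p) p = wd \<Omega> i j u p + wd \<Omega> i j v p" if "i + j \<le> 2"
    using * that by (intro wd_eqI) auto
qed

lemma
  assumes u: "H2 \<Omega> u"
  shows H2_cmult: "H2 \<Omega> (\<lambda>p. c * u p)"
    and wd_cmult: "i + j \<le> 2 \<Longrightarrow> AE p in M. wd \<Omega> i j (\<lambda>p. c * u p) p = c * wd \<Omega> i j u p"
proof -
  have *: "square_integrable M (\<lambda>p. c * wd \<Omega> i j u p)"
    "weak_deriv \<Omega> i j (\<lambda>p. c * u p) (\<lambda>p. c * wd \<Omega> i j u p)"
    if "i + j \<le> 2" for i j
    using that by (auto intro!: weak_deriv_cmult square_integrable_cmult H2_wd u)
  then show "H2 \<Omega> (\<lambda>p. c * u p)"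
    unfolding H2_def L2_iff_square_integrable
    using square_integrable_cmult[OF u[THEN H2_square_integrable]] by blast
  show "AE p in M. wd \<Omega> i j (\<lambda>p. c * u p) p = c * wd \<Omega> i j u p" if "i + j \<le> 2"
    using * that by (intro wd_eqI) auto
qed

section \<open>The closure of test functions as a vector space\<close>

lemma finite_order_le_2: "finite {(i, j). i + j \<le> (2::nat)}"
  by (rule finite_subset[of _ "{..2} \<times> {..2}"]) auto

lemma H2_norm_tendsto_0_iff:
  "(\<lambda>n. H2_norm \<Omega> (w n)) \<longlonglongrightarrow> 0 \<longleftrightarrow>
    (\<forall>i j. i + j \<le> 2 \<longrightarrow> (\<lambda>n. \<integral>p. (wd \<Omega> i j (w n) p)\<^sup>2 \<partial>M) \<longlonglongrightarrow> 0)" (is "?L \<longleftrightarrow> ?R")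
proof
  let ?S = "\<lambda>n. \<Sum>(i,j)\<in>{(i,j). i + j \<le> (2::nat)}. \<integral>p. (wd \<Omega> i j (w n) p)\<^sup>2 \<partial>M"
  assume ?L
  then have "(\<lambda>n. (H2_norm \<Omega> (w n))\<^sup>2) \<longlonglongrightarrow> 0\<^sup>2" by (rule tendsto_power)
  then have S: "?S \<longlonglongrightarrow> 0"
    by (simp add: H2_norm_def set_lebesgue_integral_M sum_nonneg case_prod_beta)
  show ?R
  proof (intro allI impI)
    fix i j :: nat assume ij: "i + j \<le> 2"
    have "(\<integral>p. (wd \<Omega> i j (w n) p)\<^sup>2 \<partial>M) \<le> ?S n" for n
      using member_le_sum[of "(i, j)" "{(i,j). i + j \<le> (2::nat)}" "\<lambda>(i, j). \<integral>p. (wd \<Omega> i j (w n) p)\<^sup>2 \<partial>M"]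
        finite_order_le_2 ij by auto
    then show "(\<lambda>n. \<integral>p. (wd \<Omega> i j (w n) p)\<^sup>2 \<partial>M) \<longlonglongrightarrow> 0"
      by (intro tendsto_sandwich[OF _ _ tendsto_const S]) auto
  qed
next
  assume ?R
  then have "(\<lambda>n. sqrt (\<Sum>(i,j)\<in>{(i,j). i + j \<le> (2::nat)}. \<integral>p. (wd \<Omega> i j (w n) p)\<^sup>2 \<partial>M))
    \<longlonglongrightarrow> sqrt (\<Sum>(i,j)\<in>{(i,j). i + j \<le> (2::nat)}. 0)"
    by (intro tendsto_intros) auto
  then show ?L by (simp add: H2_norm_def set_lebesgue_integral_M)
qed

lemma wd_test_fun_diff:
  assumes "test_fun \<Omega> \<phi>" "H2 \<Omega> u" "i + j \<le> 2"
  shows "(\<integral>p. (wd \<Omega> i j (\<lambda>p. \<phi> p - u p) p)\<^sup>2 \<partial>M) = (\<integral>p. (pd i j \<phi> p - wd \<Omega> i j u p)\<^sup>2 \<partial>M)"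
proof -
  have "AE p in M. wd \<Omega> i j (\<lambda>p. \<phi> p + - 1 * u p) p = pd i j \<phi> p - wd \<Omega> i j u p"
    using wd_add[OF H2_test_fun[OF assms(1)] H2_cmult[OF assms(2), of "-1"] assms(3)]
      test_fun_wd[OF assms(1,3)] wd_cmult[OF assms(2,3), of "-1"]
    by eventually_elim simp
  moreover have "wd \<Omega> i j (\<lambda>p. \<phi> p + - 1 * u p) \<in> borel_measurable M"
    by (intro square_integrableD(1) H2_wd H2_add H2_cmult H2_test_fun assms)
  moreover have "(\<lambda>p. pd i j \<phi> p - wd \<Omega> i j u p) \<in> borel_measurable M"
    by (intro square_integrableD(1) square_integrable_diff H2_wd test_fun_square_integrable test_fun_pd assms)
  ultimately have "(\<integral>p. (wd \<Omega> i j (\<lambda>p. \<phi> p + - 1 * u p) p)\<^sup>2 \<partial>M)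
      = (\<integral>p. (pd i j \<phi> p - wd \<Omega> i j u p)\<^sup>2 \<partial>M)"
    by (intro integral_cong_AE borel_measurable_power) auto
  then show ?thesis by simp
qed

text \<open>The chosen derivative of a difference is replaced by a classical derivative minus a
  chosen one, for each order separately; this is the form in which limits are taken.\<close>

lemma H20_iff:
  "u \<in> H20 \<Omega> \<longleftrightarrow> H2 \<Omega> u \<and> (\<exists>\<phi>. (\<forall>n. test_fun \<Omega> (\<phi> n)) \<and>
     (\<forall>i j. i + j \<le> 2 \<longrightarrow> (\<lambda>n. \<integral>p. (pd i j (\<phi> n) p - wd \<Omega> i j u p)\<^sup>2 \<partial>M) \<longlonglongrightarrow> 0))"
  unfolding H20_def mem_Collect_eq H2_norm_tendsto_0_iff
  by (intro conj_cong ex_cong1 refl) (simp add: wd_test_fun_diff)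

lemma H20_H2: "u \<in> H20 \<Omega> \<Longrightarrow> H2 \<Omega> u"
  by (simp add: H20_def)

lemma H20_approx:
  assumes "u \<in> H20 \<Omega>"
  obtains \<phi> where "\<And>n. test_fun \<Omega> (\<phi> n)"
    "\<And>i j. i + j \<le> 2 \<Longrightarrow> (\<lambda>n. \<integral>p. (pd i j (\<phi> n) p - wd \<Omega> i j u p)\<^sup>2 \<partial>M) \<longlonglongrightarrow> 0"
  using assms unfolding H20_iff by blast

lemma H20_wd: "u \<in> H20 \<Omega> \<Longrightarrow> i + j \<le> 2 \<Longrightarrow> square_integrable M (wd \<Omega> i j u)"
  by (simp add: H20_H2 H2_wd)

lemma H20_add:
  assumes u: "u \<in> H20 \<Omega>" and v: "v \<in> H20 \<Omega>"
  shows "(\<lambda>p. u p + v p) \<in> H20 \<Omega>"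
proof -
  obtain \<phi> where \<phi>: "\<And>n. test_fun \<Omega> (\<phi> n)"
    "\<And>i j. i + j \<le> 2 \<Longrightarrow> (\<lambda>n. \<integral>p. (pd i j (\<phi> n) p - wd \<Omega> i j u p)\<^sup>2 \<partial>M) \<longlonglongrightarrow> 0"
    using H20_approx[OF u] by blast
  obtain \<theta> where \<theta>: "\<And>n. test_fun \<Omega> (\<theta> n)"
    "\<And>i j. i + j \<le> 2 \<Longrightarrow> (\<lambda>n. \<integral>p. (pd i j (\<theta> n) p - wd \<Omega> i j v p)\<^sup>2 \<partial>M) \<longlonglongrightarrow> 0"
    using H20_approx[OF v] by blast
  have "(\<lambda>n. \<integral>p. (pd i j (\<lambda>p. \<phi> n p + \<theta> n p) p - wd \<Omega> i j (\<lambda>p. u p + v p) p)\<^sup>2 \<partial>M) \<longlonglongrightarrow> 0"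
    if ij: "i + j \<le> 2" for i j
  proof -
    have "(\<integral>p. (pd i j (\<lambda>p. \<phi> n p + \<theta> n p) p - wd \<Omega> i j (\<lambda>p. u p + v p) p)\<^sup>2 \<partial>M)
      = (\<integral>p. ((pd i j (\<phi> n) p - wd \<Omega> i j u p) + (pd i j (\<theta> n) p - wd \<Omega> i j v p))\<^sup>2 \<partial>M)" for n
    proof (rule integral_cong_AE)
      show "AE p in M. (pd i j (\<lambda>p. \<phi> n p + \<theta> n p) p - wd \<Omega> i j (\<lambda>p. u p + v p) p)\<^sup>2
        = ((pd i j (\<phi> n) p - wd \<Omega> i j u p) + (pd i j (\<theta> n) p - wd \<Omega> i j v p))\<^sup>2"
        using wd_add[OF H20_H2[OF u] H20_H2[OF v] ij]
        by eventually_elim (simp add: pd_add[OF \<phi>(1)[THEN test_fun_smooth] \<theta>(1)[THEN test_fun_smooth]] algebra_simps)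
    qed (intro borel_measurable_power square_integrableD(1) square_integrable_diff square_integrable_add
        test_fun_square_integrable test_fun_pd test_fun_add \<phi>(1) \<theta>(1) H2_wd H2_add H20_H2 u v ij)+
    moreover have "(\<lambda>n. \<integral>p. ((pd i j (\<phi> n) p - wd \<Omega> i j u p) + (pd i j (\<theta> n) p - wd \<Omega> i j v p))\<^sup>2 \<partial>M) \<longlonglongrightarrow> 0"
      by (intro integral_square_add_tendsto_0 square_integrable_diff
        test_fun_square_integrable test_fun_pd \<phi> \<theta> H2_wd H20_H2 u v ij)
    ultimately show ?thesis by simp
  qed
  then show ?thesis
    unfolding H20_iff using \<phi>(1) \<theta>(1)
    by (intro conjI H2_add H20_H2 u v exI[of _ "\<lambda>n p. \<phi> n p + \<theta> n p"]) (auto intro: test_fun_add)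
qed

lemma H20_cmult:
  assumes u: "u \<in> H20 \<Omega>"
  shows "(\<lambda>p. c * u p) \<in> H20 \<Omega>"
proof -
  obtain \<phi> where \<phi>: "\<And>n. test_fun \<Omega> (\<phi> n)"
    "\<And>i j. i + j \<le> 2 \<Longrightarrow> (\<lambda>n. \<integral>p. (pd i j (\<phi> n) p - wd \<Omega> i j u p)\<^sup>2 \<partial>M) \<longlonglongrightarrow> 0"
    using H20_approx[OF u] by blast
  have "(\<lambda>n. \<integral>p. (pd i j (\<lambda>p. c * \<phi> n p) p - wd \<Omega> i j (\<lambda>p. c * u p) p)\<^sup>2 \<partial>M) \<longlonglongrightarrow> 0"
    if ij: "i + j \<le> 2" for i j
  proof -
    have "(\<integral>p. (pd i j (\<lambda>p. c * \<phi> n p) p - wd \<Omega> i j (\<lambda>p. c * u p) p)\<^sup>2 \<partial>M)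
      = (\<integral>p. c\<^sup>2 * (pd i j (\<phi> n) p - wd \<Omega> i j u p)\<^sup>2 \<partial>M)" for n
    proof (rule integral_cong_AE)
      show "AE p in M. (pd i j (\<lambda>p. c * \<phi> n p) p - wd \<Omega> i j (\<lambda>p. c * u p) p)\<^sup>2
        = c\<^sup>2 * (pd i j (\<phi> n) p - wd \<Omega> i j u p)\<^sup>2"
        using wd_cmult[OF H20_H2[OF u] ij, of c]
        by eventually_elim (simp add: pd_cmult[OF \<phi>(1)[THEN test_fun_smooth]] algebra_simps power2_eq_square)
    qed (intro borel_measurable_times borel_measurable_const borel_measurable_power square_integrableD(1) square_integrable_diff
        test_fun_square_integrable test_fun_pd test_fun_cmult \<phi>(1) H2_wd H2_cmult H20_H2 u ij)+
    moreover have "(\<lambda>n. c\<^sup>2 * (\<integral>p. (pd i j (\<phi> n) p - wd \<Omega> i j u p)\<^sup>2 \<partial>M)) \<longlonglongrightarrow> c\<^sup>2 * 0"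
      by (intro tendsto_intros \<phi> ij)
    ultimately show ?thesis by simp
  qed
  then show ?thesis
    unfolding H20_iff using \<phi>(1)
    by (intro conjI H2_cmult H20_H2 u exI[of _ "\<lambda>n p. c * \<phi> n p"]) (auto intro: test_fun_cmult)
qed

lemma H20_diff:
  assumes "u \<in> H20 \<Omega>" "v \<in> H20 \<Omega>"
  shows "(\<lambda>p. u p - v p) \<in> H20 \<Omega>"
  using H20_add[OF assms(1) H20_cmult[OF assms(2), of "-1"]] by simp

section \<open>Identities and bounds that survive the limit\<close>

lemma H20_pd_mult_tendsto:
  assumes u: "u \<in> H20 \<Omega>" and \<phi>: "\<And>n. test_fun \<Omega> (\<phi> n)"
    "\<And>i j. i + j \<le> 2 \<Longrightarrow> (\<lambda>n. \<integral>p. (pd i j (\<phi> n) p - wd \<Omega> i j u p)\<^sup>2 \<partial>M) \<longlonglongrightarrow> 0"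
    and ij: "i + j \<le> 2" and kl: "k + l \<le> 2"
  shows "(\<lambda>n. \<integral>p. pd i j (\<phi> n) p * pd k l (\<phi> n) p \<partial>M) \<longlonglongrightarrow> (\<integral>p. wd \<Omega> i j u p * wd \<Omega> k l u p \<partial>M)"
  by (intro integral_mult_tendsto test_fun_square_integrable test_fun_pd \<phi> H20_wd u ij kl)

text \<open>The computation passes through third derivatives, which elements of \<open>H20\<close>
  need not have. It is therefore done for the approximating test functions, and only its two ends,
  with second derivatives alone, go to the limit.\<close>

lemma H20_mixed_eq:
  assumes u: "u \<in> H20 \<Omega>"
  shows "(\<integral>p. (wd \<Omega> 1 1 u p)\<^sup>2 \<partial>M) = (\<integral>p. wd \<Omega> 2 0 u p * wd \<Omega> 0 2 u p \<partial>M)"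
proof -
  obtain \<phi> where \<phi>: "\<And>n. test_fun \<Omega> (\<phi> n)"
    "\<And>i j. i + j \<le> 2 \<Longrightarrow> (\<lambda>n. \<integral>p. (pd i j (\<phi> n) p - wd \<Omega> i j u p)\<^sup>2 \<partial>M) \<longlonglongrightarrow> 0"
    using H20_approx[OF u] by blast
  have "(\<integral>p. pd 2 0 (\<phi> n) p * pd 0 2 (\<phi> n) p \<partial>M) = (\<integral>p. pd 1 1 (\<phi> n) p * pd 1 1 (\<phi> n) p \<partial>M)" for n
  proof -
    note x = test_fun_pdx and y = test_fun_pdy and t = \<phi>(1)[of n]
    note m = test_fun_borel_measurable_M
    have "(\<integral>p. pdx (pdx (\<phi> n)) p * pdy (pdy (\<phi> n)) p \<partial>M)
      = - (\<integral>p. pdy (pdx (pdx (\<phi> n))) p * pdy (\<phi> n) p \<partial>M)"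
      by (rule by_parts_y[OF x[OF x[OF t]] test_fun_smooth[OF y[OF t]]])
    \<comment> \<open>The next integration by parts needs \<open>pdx\<close> outermost; symmetry is
      applied to the test function \<open>pdx (\<phi> n)\<close>.\<close>
    also have "(\<integral>p. pdy (pdx (pdx (\<phi> n))) p * pdy (\<phi> n) p \<partial>M)
      = (\<integral>p. pdx (pdy (pdx (\<phi> n))) p * pdy (\<phi> n) p \<partial>M)"
      using pd_commute_AE[OF x[OF t]]
      by (intro integral_cong_AE borel_measurable_times m x y t) auto
    also have "- \<dots> = (\<integral>p. pdy (pdx (\<phi> n)) p * pdx (pdy (\<phi> n)) p \<partial>M)"
      using by_parts_x[OF y[OF x[OF t]] test_fun_smooth[OF y[OF t]]] by simp
    also have "\<dots> = (\<integral>p. pdx (pdy (\<phi> n)) p * pdx (pdy (\<phi> n)) p \<partial>M)"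
      using pd_commute_AE[OF t]
      by (intro integral_cong_AE borel_measurable_times m x y t) auto
    finally show ?thesis by (simp only: pd_simps)
  qed
  moreover note H20_pd_mult_tendsto[OF u \<phi>, of 2 0 0 2] H20_pd_mult_tendsto[OF u \<phi>, of 1 1 1 1]
  ultimately show ?thesis
    using LIMSEQ_unique by (fastforce simp: power2_eq_square)
qed

text \<open>For a test function, integration by parts shows that the integral equals its own
  negative.\<close>

lemma H20_dx_self:
  assumes u: "u \<in> H20 \<Omega>"
  shows "(\<integral>p. wd \<Omega> 1 0 u p * u p \<partial>M) = 0"
proof -
  obtain \<phi> where \<phi>: "\<And>n. test_fun \<Omega> (\<phi> n)"
    "\<And>i j. i + j \<le> 2 \<Longrightarrow> (\<lambda>n. \<integral>p. (pd i j (\<phi> n) p - wd \<Omega> i j u p)\<^sup>2 \<partial>M) \<longlonglongrightarrow> 0"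
    using H20_approx[OF u] by blast
  have "(\<integral>p. pd 1 0 (\<phi> n) p * pd 0 0 (\<phi> n) p \<partial>M) = 0" for n
    using by_parts_x[OF \<phi>(1) test_fun_smooth[OF \<phi>(1)], of n n] by (simp add: pd_simps mult.commute)
  with H20_pd_mult_tendsto[OF u \<phi>, of 1 0 0 0]
  have "(\<integral>p. wd \<Omega> 1 0 u p * wd \<Omega> 0 0 u p \<partial>M) = 0"
    by (simp add: LIMSEQ_const_iff)
  moreover have "(\<integral>p. wd \<Omega> 1 0 u p * wd \<Omega> 0 0 u p \<partial>M) = (\<integral>p. wd \<Omega> 1 0 u p * u p \<partial>M)"
    using wd_0_0[OF H20_H2[OF u]]
    by (intro integral_cong_AE borel_measurable_times square_integrableD(1) H20_wd H2_square_integrable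
        H20_H2 u) auto
  ultimately show ?thesis by simp
qed

lemma nn_integral_M_test_fun:
  assumes "test_fun \<Omega> f" "test_fun \<Omega> g"
  shows "(\<integral>\<^sup>+p. ennreal ((f p)\<^sup>2 + (g p)\<^sup>2) \<partial>lborel) = ennreal ((\<integral>p. (f p)\<^sup>2 \<partial>M) + (\<integral>p. (g p)\<^sup>2 \<partial>M))"
proof -
  have "integrable lborel (\<lambda>p. (f p)\<^sup>2)" "integrable lborel (\<lambda>p. (g p)\<^sup>2)"
    using assms test_fun_integrable_mult test_fun_smooth by (fastforce simp: power2_eq_square)+
  then show ?thesis
    using assms by (subst nn_integral_eq_integral) (auto simp: integral_M_eq test_fun_zero)
qed

text \<open>Fatou's lemma needs pointwise convergence, and L2 convergence provides it along a
  subsequence.\<close>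

lemma L2_AE_subseq:
  assumes "\<And>n. square_integrable M (\<lambda>p. f n p - g p)" "(\<lambda>n. \<integral>p. (f n p - g p)\<^sup>2 \<partial>M) \<longlonglongrightarrow> 0"
  obtains r :: "nat \<Rightarrow> nat" where "strict_mono r" "AE p in M. (\<lambda>n. f (r n) p) \<longlonglongrightarrow> g p"
proof -
  obtain r :: "nat \<Rightarrow> nat" where r: "strict_mono r" "AE p in M. (\<lambda>n. (f (r n) p - g p)\<^sup>2) \<longlonglongrightarrow> 0"
    using tendsto_L1_AE_subseq[of M "\<lambda>n p. (f n p - g p)\<^sup>2"] assms by (auto simp: square_integrable_def)
  have "AE p in M. (\<lambda>n. f (r n) p) \<longlonglongrightarrow> g p"
    using r(2)
  proof eventually_elim
    case (elim p)
    then have "(\<lambda>n. sqrt ((f (r n) p - g p)\<^sup>2)) \<longlonglongrightarrow> sqrt 0" by (rule tendsto_real_sqrt)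
    then show ?case by (simp add: tendsto_rabs_zero_iff LIM_zero_iff)
  qed
  with r(1) show ?thesis using that by blast
qed

text \<open>Applied to \<open>pdy (\<phi> n)\<close> and \<open>pdx (\<theta> n)\<close>, the
  Ladyzhenskaya bound involves only first and mixed second derivatives, whose L2 norms stay bounded
  along the approximation. Fatou transfers the bound. The hypothesis on \<Gamma>1 cannot replace
  this: it bounds the value of \<open>a1\<close> but does not make it additive.\<close>

lemma H20_gradient_product:
  assumes u: "u \<in> H20 \<Omega>" and v: "v \<in> H20 \<Omega>"
  shows "square_integrable M (\<lambda>p. wd \<Omega> 0 1 u p * wd \<Omega> 1 0 v p)"
proof -
  obtain \<phi> where \<phi>: "\<And>n. test_fun \<Omega> (\<phi> n)"
    "\<And>i j. i + j \<le> 2 \<Longrightarrow> (\<lambda>n. \<integral>p. (pd i j (\<phi> n) p - wd \<Omega> i j u p)\<^sup>2 \<partial>M) \<longlonglongrightarrow> 0"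
    using H20_approx[OF u] by blast
  obtain \<theta> where \<theta>: "\<And>n. test_fun \<Omega> (\<theta> n)"
    "\<And>i j. i + j \<le> 2 \<Longrightarrow> (\<lambda>n. \<integral>p. (pd i j (\<theta> n) p - wd \<Omega> i j v p)\<^sup>2 \<partial>M) \<longlonglongrightarrow> 0"
    using H20_approx[OF v] by blast
  define S where "S i j \<psi> = (\<integral>p. (pd i j \<psi> p)\<^sup>2 \<partial>M)" for i j \<psi>
  define K where "K n = (S 0 1 (\<phi> n) + S 1 1 (\<phi> n)) * (S 1 0 (\<theta> n) + S 1 1 (\<theta> n))" for n
  have "convergent (\<lambda>n. S i j (\<phi> n))" "convergent (\<lambda>n. S i j (\<theta> n))" if "i + j \<le> 2" for i j
    using H20_pd_mult_tendsto[OF u \<phi> that that] H20_pd_mult_tendsto[OF v \<theta> that that]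
    by (auto simp: S_def power2_eq_square convergent_def)
  then have "convergent K"
    unfolding K_def by (intro convergent_mult convergent_add) auto
  then obtain C where C: "\<And>n. K n \<le> C"
    using convergent_imp_Bseq[of K] unfolding Bseq_def by (metis abs_le_D1 real_norm_def)
  have bound: "(\<integral>\<^sup>+p. ennreal ((pd 0 1 (\<phi> n) p)\<^sup>2 * (pd 1 0 (\<theta> m) p)\<^sup>2) \<partial>M)
      \<le> ennreal ((S 0 1 (\<phi> n) + S 1 1 (\<phi> n)) * (S 1 0 (\<theta> m) + S 1 1 (\<theta> m)))" for n m
  proof -
    \<comment> \<open>The product bound yields \<open>pdy (pdx _)\<close>, whereas
      \<open>S 1 1\<close> is formed with the other order.\<close>
    have "(\<integral>p. (pdy (pdx (\<theta> m)) p)\<^sup>2 \<partial>M) = S 1 1 (\<theta> m)"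
      unfolding S_def pd_simps using pd_commute_AE[OF \<theta>(1)[of m]]
      by (intro integral_cong_AE borel_measurable_power test_fun_borel_measurable_M
          test_fun_pdx test_fun_pdy \<theta>(1)) (auto elim!: eventually_mono)
    moreover have "(\<integral>\<^sup>+p. ennreal ((pd 0 1 (\<phi> n) p)\<^sup>2 * (pd 1 0 (\<theta> m) p)\<^sup>2) \<partial>M)
      \<le> (\<integral>\<^sup>+p. ennreal ((pdy (\<phi> n) p)\<^sup>2 * (pdx (\<theta> m) p)\<^sup>2) \<partial>lborel)"
      by (subst nn_integral_restrict_space) (auto simp: pd_simps indicator_def intro!: nn_integral_mono)
    moreover note nn_integral_product_squares_le[OF test_fun_pdy[OF \<phi>(1)[of n]] test_fun_pdx[OF \<theta>(1)[of m]]]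
    ultimately show ?thesis
      using \<phi>(1)[of n] \<theta>(1)[of m]
      by (simp add: nn_integral_M_test_fun test_fun_pdx test_fun_pdy ennreal_mult S_def pd_simps del: ennreal_plus)
  qed
  have d: "square_integrable M (\<lambda>p. pd 0 1 (\<phi> n) p - wd \<Omega> 0 1 u p)"
    "square_integrable M (\<lambda>p. pd 1 0 (\<theta> n) p - wd \<Omega> 1 0 v p)" for n
    by (intro square_integrable_diff test_fun_square_integrable test_fun_pd \<phi> \<theta> H20_wd u v; simp)+
  obtain r where r: "strict_mono r" "AE p in M. (\<lambda>n. pd 0 1 (\<phi> (r n)) p) \<longlonglongrightarrow> wd \<Omega> 0 1 u p"
    using L2_AE_subseq[OF d(1) \<phi>(2)] by auto
  \<comment> \<open>The second subsequence is extracted from the first, so that both factors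
    converge along \<open>r (s n)\<close>.\<close>
  have "(\<lambda>n. \<integral>p. (pd 1 0 (\<theta> (r n)) p - wd \<Omega> 1 0 v p)\<^sup>2 \<partial>M) \<longlonglongrightarrow> 0"
    using LIMSEQ_subseq_LIMSEQ[OF \<theta>(2)[of 1 0] r(1)] by (simp add: o_def)
  then obtain s where s: "strict_mono s" "AE p in M. (\<lambda>n. pd 1 0 (\<theta> (r (s n))) p) \<longlonglongrightarrow> wd \<Omega> 1 0 v p"
    using L2_AE_subseq[OF d(2)] by blast
  define h where "h n p = (pd 0 1 (\<phi> (r (s n))) p)\<^sup>2 * (pd 1 0 (\<theta> (r (s n))) p)\<^sup>2" for n p
  have hm: "h n \<in> borel_measurable M" for n
    unfolding h_def
    by (intro borel_measurable_times borel_measurable_power test_fun_borel_measurable_M test_fun_pd \<phi>(1) \<theta>(1))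
  have "AE p in M. (\<lambda>n. h n p) \<longlonglongrightarrow> (wd \<Omega> 0 1 u p)\<^sup>2 * (wd \<Omega> 1 0 v p)\<^sup>2"
    using r(2) s(2)
  proof eventually_elim
    case (elim p)
    show ?case
      unfolding h_def
      using LIMSEQ_subseq_LIMSEQ[OF elim(1) s(1)] elim(2)
      by (intro tendsto_mult tendsto_power) (simp_all add: o_def)
  qed
  then have "AE p in M. ennreal ((wd \<Omega> 0 1 u p)\<^sup>2 * (wd \<Omega> 1 0 v p)\<^sup>2) = liminf (\<lambda>n. ennreal (h n p))"
    by eventually_elim (auto intro!: lim_imp_Liminf[symmetric] tendsto_ennrealI)
  then have "(\<integral>\<^sup>+p. ennreal ((wd \<Omega> 0 1 u p)\<^sup>2 * (wd \<Omega> 1 0 v p)\<^sup>2) \<partial>M)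
      = (\<integral>\<^sup>+p. liminf (\<lambda>n. ennreal (h n p)) \<partial>M)"
    by (rule nn_integral_cong_AE)
  also have "\<dots> \<le> liminf (\<lambda>n. \<integral>\<^sup>+p. ennreal (h n p) \<partial>M)"
    using hm by (intro nn_integral_liminf) auto
  also have "\<dots> \<le> liminf (\<lambda>n. ennreal C)"
    using bound C unfolding h_def K_def
    by (intro Liminf_mono always_eventually allI) (meson ennreal_leI order_trans)
  also have "\<dots> < \<infinity>" by (simp add: Liminf_const)
  finally have "integrable M (\<lambda>p. (wd \<Omega> 0 1 u p)\<^sup>2 * (wd \<Omega> 1 0 v p)\<^sup>2)"
    using H20_wd[OF u, of 0 1, THEN square_integrableD(1)] H20_wd[OF v, of 1 0, THEN square_integrableD(1)]
    by (intro integrableI_bounded) (auto simp: abs_mult)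
  then show ?thesis
    using H20_wd[OF u, of 0 1, THEN square_integrableD(1)] H20_wd[OF v, of 1 0, THEN square_integrableD(1)]
    by (simp add: square_integrable_def power_mult_distrib)
qed

section \<open>The quasi-optimal error estimate\<close>

lemma lap_square_integrable: "u \<in> H20 \<Omega> \<Longrightarrow> square_integrable M (lap \<Omega> u)"
  unfolding lap_def[abs_def] by (intro square_integrable_add H20_wd) simp_all

text \<open>\<open>H2_semi\<close> is the norm of the Hessian; it agrees with the norm of the Laplacian because two
  integrations by parts give \<open>\<integral> u\<^sub>x\<^sub>x u\<^sub>y\<^sub>y = \<integral> u\<^sub>x\<^sub>y\<^sup>2\<close> for test functions.\<close>

lemma H2_semi_eq_lap:
  assumes u: "u \<in> H20 \<Omega>"
  shows "H2_semi \<Omega> u = sqrt (\<integral>p. (lap \<Omega> u p)\<^sup>2 \<partial>M)"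
proof -
  have s: "square_integrable M (wd \<Omega> 2 0 u)" "square_integrable M (wd \<Omega> 1 1 u)"
    "square_integrable M (wd \<Omega> 0 2 u)"
    using H20_wd[OF u] by simp_all
  note i = s[THEN square_integrableD(2)] square_integrable_mult[OF s(1,3)]
  have "(\<integral>p. (wd \<Omega> 2 0 u p)\<^sup>2 + 2 * (wd \<Omega> 1 1 u p)\<^sup>2 + (wd \<Omega> 0 2 u p)\<^sup>2 \<partial>M)
    = (\<integral>p. (wd \<Omega> 2 0 u p)\<^sup>2 \<partial>M) + 2 * (\<integral>p. (wd \<Omega> 1 1 u p)\<^sup>2 \<partial>M) + (\<integral>p. (wd \<Omega> 0 2 u p)\<^sup>2 \<partial>M)"
    using i by simp
  also have "\<dots> = (\<integral>p. (wd \<Omega> 2 0 u p)\<^sup>2 + 2 * (wd \<Omega> 2 0 u p * wd \<Omega> 0 2 u p) + (wd \<Omega> 0 2 u p)\<^sup>2 \<partial>M)"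
    unfolding H20_mixed_eq[OF u] using i by simp
  also have "\<dots> = (\<integral>p. (lap \<Omega> u p)\<^sup>2 \<partial>M)"
    by (rule Bochner_Integration.integral_cong) (simp_all add: lap_def power2_eq_square algebra_simps)
  finally show ?thesis by (simp add: H2_semi_def set_lebesgue_integral_M)
qed

lemma H2_semi_nonneg: "u \<in> H20 \<Omega> \<Longrightarrow> 0 \<le> H2_semi \<Omega> u"
  by (simp add: H2_semi_eq_lap)

section \<open>Additivity and bounds of the forms\<close>

lemma lap_add:
  assumes "u \<in> H20 \<Omega>" "v \<in> H20 \<Omega>"
  shows "AE p in M. lap \<Omega> (\<lambda>p. u p + v p) p = lap \<Omega> u p + lap \<Omega> v p"
  using wd_add[OF assms[THEN H20_H2], of 2 0, simplified] wd_add[OF assms[THEN H20_H2], of 0 2, simplified]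
  by eventually_elim (simp add: lap_def)

lemma H2_semi_triangle:
  assumes "u \<in> H20 \<Omega>" "v \<in> H20 \<Omega>"
  shows "H2_semi \<Omega> (\<lambda>p. u p + v p) \<le> H2_semi \<Omega> u + H2_semi \<Omega> v"
proof -
  have "(\<integral>p. (lap \<Omega> (\<lambda>p. u p + v p) p)\<^sup>2 \<partial>M) = (\<integral>p. (lap \<Omega> u p + lap \<Omega> v p)\<^sup>2 \<partial>M)"
    using lap_add[OF assms]
    by (intro integral_cong_AE borel_measurable_power square_integrableD(1) lap_square_integrable
        square_integrable_add H20_add assms) (auto elim!: eventually_mono)
  then show ?thesis
    using sqrt_integral_triangle[OF assms[THEN lap_square_integrable]]
    by (simp add: H2_semi_eq_lap H20_add assms)
qed

lemma a0_M: "a0 \<Omega> R u v = inverse R * (\<integral>p. lap \<Omega> u p * lap \<Omega> v p \<partial>M)"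
  by (simp add: a0_def set_lebesgue_integral_M)

lemma a0_self: "u \<in> H20 \<Omega> \<Longrightarrow> a0 \<Omega> R u u = inverse R * (H2_semi \<Omega> u)\<^sup>2"
  by (simp add: a0_M H2_semi_eq_lap power2_eq_square[symmetric])

lemma a0_bound:
  assumes "u \<in> H20 \<Omega>" "v \<in> H20 \<Omega>" "R > 0"
  shows "\<bar>a0 \<Omega> R u v\<bar> \<le> inverse R * (H2_semi \<Omega> u * H2_semi \<Omega> v)"
  using Cauchy_Schwarz_integral[OF assms(1,2)[THEN lap_square_integrable]] assms
  by (simp add: a0_M H2_semi_eq_lap abs_mult)

lemma a0_add:
  assumes u: "u \<in> H20 \<Omega>" and v: "v \<in> H20 \<Omega>" and w: "w \<in> H20 \<Omega>"
  shows "a0 \<Omega> R (\<lambda>p. u p + v p) w = a0 \<Omega> R u w + a0 \<Omega> R v w"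
proof -
  have "(\<integral>p. lap \<Omega> (\<lambda>p. u p + v p) p * lap \<Omega> w p \<partial>M)
      = (\<integral>p. (lap \<Omega> u p + lap \<Omega> v p) * lap \<Omega> w p \<partial>M)"
    using lap_add[OF u v]
    by (intro integral_cong_AE borel_measurable_times square_integrableD(1) lap_square_integrable
        square_integrable_add H20_add u v w) (auto elim!: eventually_mono)
  also have "\<dots> = (\<integral>p. lap \<Omega> u p * lap \<Omega> w p \<partial>M) + (\<integral>p. lap \<Omega> v p * lap \<Omega> w p \<partial>M)"
    by (simp add: distrib_right square_integrable_mult lap_square_integrable u v w)
  finally show ?thesis by (simp add: a0_M distrib_left)
qed

lemma a2_M: "a2 \<Omega> R u v = - inverse R * (\<integral>p. wd \<Omega> 1 0 u p * v p \<partial>M)"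
  by (simp add: a2_def set_lebesgue_integral_M)

lemma a2_self: "u \<in> H20 \<Omega> \<Longrightarrow> a2 \<Omega> R u u = 0"
  unfolding a2_M by (simp only: H20_dx_self mult_zero_right)

lemma a2_add:
  assumes u: "u \<in> H20 \<Omega>" and v: "v \<in> H20 \<Omega>" and w: "w \<in> H20 \<Omega>"
  shows "a2 \<Omega> R (\<lambda>p. u p + v p) w = a2 \<Omega> R u w + a2 \<Omega> R v w"
proof -
  have s: "square_integrable M (wd \<Omega> 1 0 z)" if "z \<in> H20 \<Omega>" for z
    using H20_wd[OF that] by simp
  have w': "square_integrable M w" by (rule H2_square_integrable[OF H20_H2[OF w]])
  have "(\<integral>p. wd \<Omega> 1 0 (\<lambda>p. u p + v p) p * w p \<partial>M) = (\<integral>p. (wd \<Omega> 1 0 u p + wd \<Omega> 1 0 v p) * w p \<partial>M)"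
    using wd_add[OF u[THEN H20_H2] v[THEN H20_H2], of 1 0]
    by (intro integral_cong_AE borel_measurable_times square_integrableD(1) s w'
        square_integrable_add H20_add u v) (auto elim!: eventually_mono)
  also have "\<dots> = (\<integral>p. wd \<Omega> 1 0 u p * w p \<partial>M) + (\<integral>p. wd \<Omega> 1 0 v p * w p \<partial>M)"
    using square_integrable_mult[OF s[OF u] w'] square_integrable_mult[OF s[OF v] w']
    by (simp add: distrib_right)
  finally show ?thesis by (simp only: a2_M distrib_left)
qed

text \<open>Isolating this factor makes \<open>a1\<close> an L2 pairing with the Laplacian.\<close>

definition jacobian :: "(R2 \<Rightarrow> real) \<Rightarrow> (R2 \<Rightarrow> real) \<Rightarrow> R2 \<Rightarrow> real" where
  "jacobian u v p = wd \<Omega> 0 1 u p * wd \<Omega> 1 0 v p - wd \<Omega> 1 0 u p * wd \<Omega> 0 1 v p"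

lemma jacobian_square_integrable:
  "u \<in> H20 \<Omega> \<Longrightarrow> v \<in> H20 \<Omega> \<Longrightarrow> square_integrable M (jacobian u v)"
  unfolding jacobian_def[abs_def]
  using H20_gradient_product[of u v] H20_gradient_product[of v u]
  by (intro square_integrable_diff) (simp_all add: mult.commute)

lemma jacobian_add:
  assumes "u \<in> H20 \<Omega>" "v \<in> H20 \<Omega>"
  shows "AE p in M. jacobian (\<lambda>p. u p + v p) w p = jacobian u w p + jacobian v w p"
  using wd_add[OF assms[THEN H20_H2], of 1 0, simplified] wd_add[OF assms[THEN H20_H2], of 0 1, simplified]
  by eventually_elim (simp add: jacobian_def algebra_simps)

lemma a1_M: "a1 \<Omega> z u v = (\<integral>p. lap \<Omega> z p * jacobian u v p \<partial>M)"
  by (simp add: a1_def set_lebesgue_integral_M jacobian_def)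

text \<open>The cancellation is pointwise, whatever representatives \<open>wd\<close> has
  chosen.\<close>

lemma a1_self: "a1 \<Omega> z u u = 0"
  by (simp add: a1_M jacobian_def mult.commute)

lemma a1_add_1:
  assumes u: "u \<in> H20 \<Omega>" and v: "v \<in> H20 \<Omega>" and x: "x \<in> H20 \<Omega>" and y: "y \<in> H20 \<Omega>"
  shows "a1 \<Omega> (\<lambda>p. u p + v p) x y = a1 \<Omega> u x y + a1 \<Omega> v x y"
proof -
  have "a1 \<Omega> (\<lambda>p. u p + v p) x y = (\<integral>p. (lap \<Omega> u p + lap \<Omega> v p) * jacobian x y p \<partial>M)"
    unfolding a1_M using lap_add[OF u v]
    by (intro integral_cong_AE borel_measurable_times square_integrableD(1) lap_square_integrable
        square_integrable_add jacobian_square_integrable H20_add u v x y) (auto elim!: eventually_mono)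
  also have "\<dots> = a1 \<Omega> u x y + a1 \<Omega> v x y"
    by (simp add: a1_M distrib_right square_integrable_mult lap_square_integrable
        jacobian_square_integrable u v x y)
  finally show ?thesis .
qed

lemma a1_add_2:
  assumes u: "u \<in> H20 \<Omega>" and v: "v \<in> H20 \<Omega>" and x: "x \<in> H20 \<Omega>" and y: "y \<in> H20 \<Omega>"
  shows "a1 \<Omega> x (\<lambda>p. u p + v p) y = a1 \<Omega> x u y + a1 \<Omega> x v y"
proof -
  have "a1 \<Omega> x (\<lambda>p. u p + v p) y = (\<integral>p. lap \<Omega> x p * (jacobian u y p + jacobian v y p) \<partial>M)"
    unfolding a1_M using jacobian_add[OF u v, of y]
    by (intro integral_cong_AE borel_measurable_times square_integrableD(1) lap_square_integrable
        square_integrable_add jacobian_square_integrable H20_add u v x y) (auto elim!: eventually_mono)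
  also have "\<dots> = a1 \<Omega> x u y + a1 \<Omega> x v y"
    by (simp add: a1_M distrib_left square_integrable_mult lap_square_integrable
        jacobian_square_integrable u v x y)
  finally show ?thesis .
qed

text \<open>The continuity constant in \<open>Hminus2\<close> bounds the quotients, so the supremum
  is a genuine one and dominates each of them.\<close>

lemma dual_norm_upper:
  assumes F: "Hminus2 \<Omega> F" and v: "v \<in> H20 \<Omega>" and nz: "H2_semi \<Omega> v \<noteq> 0"
  shows "\<bar>F v\<bar> \<le> dual_norm \<Omega> F * H2_semi \<Omega> v"
proof -
  obtain B where B: "\<And>u. u \<in> H20 \<Omega> \<Longrightarrow> \<bar>F u\<bar> \<le> B * H2_semi \<Omega> u"
    using F unfolding Hminus2_def by blast
  have pos: "H2_semi \<Omega> u > 0" if "u \<in> H20 \<Omega>" "H2_semi \<Omega> u \<noteq> 0" for u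
    using H2_semi_nonneg[OF that(1)] that(2) by simp
  have "\<bar>F v\<bar> / H2_semi \<Omega> v \<le> dual_norm \<Omega> F"
    unfolding dual_norm_def
  proof (rule cSup_upper)
    show "bdd_above ((\<lambda>v. \<bar>F v\<bar> / H2_semi \<Omega> v) ` {v \<in> H20 \<Omega>. H2_semi \<Omega> v \<noteq> 0})"
      using B pos by (intro bdd_aboveI[of _ B]) (auto simp: divide_le_eq)
  qed (use v nz in auto)
  then show ?thesis using pos[OF v nz] by (simp add: divide_le_eq)
qed

text \<open>Testing with the solution itself kills the convective and the Coriolis term.\<close>

lemma solution_bound:
  assumes u: "u \<in> H20 \<Omega>" and R: "Rey > 0" "Ross > 0" and F: "Hminus2 \<Omega> F"
    and D: "0 \<le> dual_norm \<Omega> F"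
    and eq: "a0 \<Omega> Rey u u + a1 \<Omega> u u u + a2 \<Omega> Ross u u = ell Ross F u"
  shows "H2_semi \<Omega> u \<le> Rey * inverse Ross * dual_norm \<Omega> F"
proof (cases "H2_semi \<Omega> u = 0")
  case True
  then show ?thesis using R D by simp
next
  case False
  then have pos: "H2_semi \<Omega> u > 0" using H2_semi_nonneg[OF u] by simp
  have "inverse Rey * (H2_semi \<Omega> u)\<^sup>2 = inverse Ross * F u"
    using eq by (simp add: a0_self a1_self a2_self u ell_def)
  also have "\<dots> \<le> inverse Ross * (dual_norm \<Omega> F * H2_semi \<Omega> u)"
    using dual_norm_upper[OF F u False] R by (intro mult_left_mono) auto
  finally have "Rey * (inverse Rey * (H2_semi \<Omega> u)\<^sup>2) \<le> Rey * (inverse Ross * (dual_norm \<Omega> F * H2_semi \<Omega> u))"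
    using R by (intro mult_left_mono) auto
  then have "H2_semi \<Omega> u * H2_semi \<Omega> u \<le> (Rey * inverse Ross * dual_norm \<Omega> F) * H2_semi \<Omega> u"
    using R by (simp add: power2_eq_square mult.assoc[symmetric])
  then show ?thesis using pos by (simp add: mult_le_cancel_right)
qed

text \<open>Conformity makes \<xi> admissible in both equations, so the loads cancel. The competitor
  \<open>vh\<close> stays fixed here; since the constant is independent of it, the infimum can be
  taken afterwards.\<close>

lemma best_approximation:
  fixes Rey Ross \<Gamma>1 \<Gamma>2 :: real
  assumes R: "Rey > 0" "Ross > 0" and F: "Hminus2 \<Omega> F" and Xh: "conforming_fe_space \<Omega> Xh"
    and G: "\<Gamma>1 > 0" "\<Gamma>2 > 0"
    and G1_bound: "\<And>z x v. z \<in> H20 \<Omega> \<Longrightarrow> x \<in> H20 \<Omega> \<Longrightarrow> v \<in> H20 \<Omega> \<Longrightarrow>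
        \<bar>a1 \<Omega> z x v\<bar> \<le> \<Gamma>1 * H2_semi \<Omega> z * H2_semi \<Omega> x * H2_semi \<Omega> v"
    and G2_bound: "\<And>x v. x \<in> H20 \<Omega> \<Longrightarrow> v \<in> H20 \<Omega> \<Longrightarrow>
        \<bar>a2 \<Omega> Ross x v\<bar> \<le> inverse Ross * \<Gamma>2 * H2_semi \<Omega> x * H2_semi \<Omega> v"
    and psi: "\<psi> \<in> H20 \<Omega>"
    and psi_eq: "\<And>v. v \<in> H20 \<Omega> \<Longrightarrow>
        a0 \<Omega> Rey \<psi> v + a1 \<Omega> \<psi> \<psi> v + a2 \<Omega> Ross \<psi> v = ell Ross F v"
    and psih: "\<psi>\<^sub>h \<in> Xh"
    and psih_eq: "\<And>vh. vh \<in> Xh \<Longrightarrow>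
        a0 \<Omega> Rey \<psi>\<^sub>h vh + a1 \<Omega> \<psi>\<^sub>h \<psi>\<^sub>h vh + a2 \<Omega> Ross \<psi>\<^sub>h vh = ell Ross F vh"
    and D: "0 \<le> dual_norm \<Omega> F"
    and small: "\<Gamma>1 * Rey * inverse Ross * dual_norm \<Omega> F \<le> inverse Rey"
    and vh: "vh \<in> Xh"
  shows "(inverse Rey - \<Gamma>1 * Rey * inverse Ross * dual_norm \<Omega> F) * H2_semi \<Omega> (\<lambda>p. \<psi> p - \<psi>\<^sub>h p)
    \<le> (inverse Ross * \<Gamma>2 + 2 * inverse Rey + \<Gamma>1 * Rey * inverse Ross * dual_norm \<Omega> F)
      * H2_semi \<Omega> (\<lambda>p. \<psi> p - vh p)"
proof -
  define \<eta> \<xi> where "\<eta> p = \<psi> p - vh p" and "\<xi> p = vh p - \<psi>\<^sub>h p" for p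
  define m where "m = H2_semi \<Omega>"
  define N where "N = Rey * inverse Ross * dual_norm \<Omega> F"
  have Xh': "Xh \<subseteq> H20 \<Omega>" "\<And>u v. u \<in> Xh \<Longrightarrow> v \<in> Xh \<Longrightarrow> (\<lambda>p. u p + v p) \<in> Xh"
    "\<And>c u. u \<in> Xh \<Longrightarrow> (\<lambda>p. c * u p) \<in> Xh"
    using Xh unfolding conforming_fe_space_def by auto
  have \<xi>h: "\<xi> \<in> Xh"
    using Xh'(2)[OF vh Xh'(3)[OF psih, of "-1"]] by (simp add: \<xi>_def[abs_def])
  have h: "\<psi>\<^sub>h \<in> H20 \<Omega>" and \<xi>: "\<xi> \<in> H20 \<Omega>" using psih \<xi>h Xh'(1) by auto
  have \<eta>: "\<eta> \<in> H20 \<Omega>" using H20_diff[OF psi] vh Xh'(1) by (auto simp: \<eta>_def[abs_def])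
  note e = H20_add[OF \<eta> \<xi>]
  have \<psi>: "\<psi> = (\<lambda>p. \<psi>\<^sub>h p + (\<eta> p + \<xi> p))" by (simp add: \<eta>_def \<xi>_def)
  have nn: "0 \<le> m \<eta>" "0 \<le> m \<xi>" using H2_semi_nonneg \<eta> \<xi> by (auto simp: m_def)
  have b: "m \<psi> \<le> N" "m \<psi>\<^sub>h \<le> N"
    unfolding m_def N_def
    by (rule solution_bound[OF psi R F D psi_eq[OF psi]], rule solution_bound[OF h R F D psih_eq[OF psih]])
  have "a0 \<Omega> Rey \<psi> \<xi> = a0 \<Omega> Rey \<psi>\<^sub>h \<xi> + (a0 \<Omega> Rey \<eta> \<xi> + a0 \<Omega> Rey \<xi> \<xi>)"
    by (subst \<psi>) (simp only: a0_add h e \<eta> \<xi>)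
  moreover have "a2 \<Omega> Ross \<psi> \<xi> = a2 \<Omega> Ross \<psi>\<^sub>h \<xi> + (a2 \<Omega> Ross \<eta> \<xi> + a2 \<Omega> Ross \<xi> \<xi>)"
    by (subst \<psi>) (simp only: a2_add h e \<eta> \<xi>)
  \<comment> \<open>The first slot is expanded first, and the second slot only in the term with the
    discrete solution. Thus each remaining term carries a solution, bounded by \<open>N\<close>, and
    the one with \<xi> in both last slots vanishes.\<close>
  moreover have "a1 \<Omega> \<psi> \<psi> \<xi> = a1 \<Omega> \<psi>\<^sub>h \<psi> \<xi> + (a1 \<Omega> \<eta> \<psi> \<xi> + a1 \<Omega> \<xi> \<psi> \<xi>)"
    by (subst (1) \<psi>) (simp only: a1_add_1 h e \<eta> \<xi> psi)
  moreover have "a1 \<Omega> \<psi>\<^sub>h \<psi> \<xi> = a1 \<Omega> \<psi>\<^sub>h \<psi>\<^sub>h \<xi> + (a1 \<Omega> \<psi>\<^sub>h \<eta> \<xi> + a1 \<Omega> \<psi>\<^sub>h \<xi> \<xi>)"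
    by (subst \<psi>) (simp only: a1_add_2 h e \<eta> \<xi>)
  ultimately have "inverse Rey * (m \<xi>)\<^sup>2 = - a0 \<Omega> Rey \<eta> \<xi> - a1 \<Omega> \<eta> \<psi> \<xi> - a1 \<Omega> \<xi> \<psi> \<xi>
      - a1 \<Omega> \<psi>\<^sub>h \<eta> \<xi> - a2 \<Omega> Ross \<eta> \<xi>"
    using psi_eq[OF \<xi>] psih_eq[OF \<xi>h] a0_self[OF \<xi>, of Rey] a2_self[OF \<xi>, of Ross]
      a1_self[of "\<psi>\<^sub>h" \<xi>] unfolding m_def by linarith
  also have "\<dots> \<le> inverse Rey * (m \<eta> * m \<xi>) + \<Gamma>1 * m \<eta> * N * m \<xi> + \<Gamma>1 * m \<xi> * N * m \<xi>
      + \<Gamma>1 * N * m \<eta> * m \<xi> + inverse Ross * \<Gamma>2 * m \<eta> * m \<xi>"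
  \<comment> \<open>Two convective terms contain \<eta>; the third is quadratic in \<xi> and moves
    to the left side.\<close>
  proof -
    have "\<Gamma>1 * m \<eta> * m \<psi> * m \<xi> \<le> \<Gamma>1 * m \<eta> * N * m \<xi>" "\<Gamma>1 * m \<xi> * m \<psi> * m \<xi> \<le> \<Gamma>1 * m \<xi> * N * m \<xi>"
      "\<Gamma>1 * m \<psi>\<^sub>h * m \<eta> * m \<xi> \<le> \<Gamma>1 * N * m \<eta> * m \<xi>"
      using b nn G by (auto intro!: mult_right_mono mult_left_mono)
    then show ?thesis
      using a0_bound[OF \<eta> \<xi> R(1)] G1_bound[OF \<eta> psi \<xi>] G1_bound[OF \<xi> psi \<xi>] G1_bound[OF h \<eta> \<xi>]
        G2_bound[OF \<eta> \<xi>]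
      unfolding m_def[symmetric] by linarith
  qed
  finally have "((inverse Rey - \<Gamma>1 * N) * m \<xi>) * m \<xi>
      \<le> ((inverse Rey + 2 * (\<Gamma>1 * N) + inverse Ross * \<Gamma>2) * m \<eta>) * m \<xi>"
    by (simp add: algebra_simps power2_eq_square)
  moreover have "0 \<le> (inverse Rey + 2 * (\<Gamma>1 * N) + inverse Ross * \<Gamma>2) * m \<eta>"
    using R G D nn by (intro mult_nonneg_nonneg add_nonneg_nonneg) (auto simp: N_def)
  \<comment> \<open>If the seminorm of \<xi> is zero it cannot be cancelled, but then the left side
    is zero and the right side nonnegative.\<close>
  ultimately have \<xi>_le: "(inverse Rey - \<Gamma>1 * N) * m \<xi> \<le> (inverse Rey + 2 * (\<Gamma>1 * N) + inverse Ross * \<Gamma>2) * m \<eta>"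
    using nn(2) by (cases "m \<xi> = 0") (auto simp: mult_le_cancel_right)
  have "m (\<lambda>p. \<eta> p + \<xi> p) \<le> m \<eta> + m \<xi>"
    unfolding m_def by (rule H2_semi_triangle[OF \<eta> \<xi>])
  then have "(inverse Rey - \<Gamma>1 * N) * m (\<lambda>p. \<eta> p + \<xi> p) \<le> (inverse Rey - \<Gamma>1 * N) * (m \<eta> + m \<xi>)"
    using small by (intro mult_left_mono) (auto simp: N_def mult.assoc)
  also have "\<dots> \<le> (inverse Ross * \<Gamma>2 + 2 * inverse Rey + \<Gamma>1 * N) * m \<eta>"
    using \<xi>_le by (simp add: algebra_simps)
  finally show ?thesis
    by (simp add: m_def N_def \<eta>_def[abs_def] \<xi>_def[abs_def] mult.assoc)
qed

end

theorem theorem4p1: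
  fixes \<Omega> :: "R2 set" and Rey Ross \<Gamma>1 \<Gamma>2 :: real
    and F :: "(R2 \<Rightarrow> real) \<Rightarrow> real"
    and Xh :: "(R2 \<Rightarrow> real) set" and \<psi> \<psi>\<^sub>h :: "R2 \<Rightarrow> real"
  assumes dom: "polygonal_domain \<Omega>"
    and Rey: "Rey > 0" and Ross: "Ross > 0"
    and F: "Hminus2 \<Omega> F"
    and Xh: "conforming_fe_space \<Omega> Xh"
    and G1: "\<Gamma>1 > 0"
    and G1_bound: "\<forall>z\<in>H20 \<Omega>. \<forall>\<psi>'\<in>H20 \<Omega>. \<forall>v\<in>H20 \<Omega>.
        \<bar>a1 \<Omega> z \<psi>' v\<bar> \<le> \<Gamma>1 * H2_semi \<Omega> z * H2_semi \<Omega> \<psi>' * H2_semi \<Omega> v"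
    and G2: "\<Gamma>2 > 0"
    and G2_bound: "\<forall>\<psi>'\<in>H20 \<Omega>. \<forall>v\<in>H20 \<Omega>.
        \<bar>a2 \<Omega> Ross \<psi>' v\<bar> \<le> inverse Ross * \<Gamma>2 * H2_semi \<Omega> \<psi>' * H2_semi \<Omega> v"
    and psi: "\<psi> \<in> H20 \<Omega>"
    and psi_eq: "\<forall>v\<in>H20 \<Omega>.
        a0 \<Omega> Rey \<psi> v + a1 \<Omega> \<psi> \<psi> v + a2 \<Omega> Ross \<psi> v = ell Ross F v"
    and psih: "\<psi>\<^sub>h \<in> Xh"
    and psih_eq: "\<forall>vh\<in>Xh.
        a0 \<Omega> Rey \<psi>\<^sub>h vh + a1 \<Omega> \<psi>\<^sub>h \<psi>\<^sub>h vh + a2 \<Omega> Ross \<psi>\<^sub>h vh = ell Ross F vh"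
    and small: "Rey powr -2 * Ross \<ge> \<Gamma>1 * dual_norm \<Omega> F"
  shows "(inverse Rey - \<Gamma>1 * Rey * inverse Ross * dual_norm \<Omega> F)
           * H2_semi \<Omega> (\<lambda>p. \<psi> p - \<psi>\<^sub>h p)
         \<le> (inverse Ross * \<Gamma>2 + 2 * inverse Rey + \<Gamma>1 * Rey * inverse Ross * dual_norm \<Omega> F)
           * (INF vh\<in>Xh. H2_semi \<Omega> (\<lambda>p. \<psi> p - vh p))"
proof -
  interpret bounded_open \<Omega>
    using dom unfolding polygonal_domain_def by unfold_locales auto
  have sub: "Xh \<subseteq> H20 \<Omega>" and zero: "(\<lambda>p. 0) \<in> Xh"
    using Xh unfolding conforming_fe_space_def by auto
  show ?thesis
  proof (cases "\<exists>v\<in>H20 \<Omega>. H2_semi \<Omega> v \<noteq> 0")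
    \<comment> \<open>If every seminorm vanishes, \<open>dual_norm\<close> is the \<open>Sup\<close>
      of the empty set and its sign is unknown. Both sides of the claim are then zero.\<close>
    case False
    then have "H2_semi \<Omega> (\<lambda>p. \<psi> p - vh p) = 0" if "vh \<in> Xh" for vh
      using H20_diff[OF psi] sub that by blast
    moreover from this zero have "(INF vh\<in>Xh. H2_semi \<Omega> (\<lambda>p. \<psi> p - vh p)) = 0"
      by (subst INF_cong[where D = "\<lambda>_. 0", OF refl]) (auto intro!: cINF_const)
    ultimately show ?thesis using psih by simp
  next
    case True
    then obtain v where v: "v \<in> H20 \<Omega>" "H2_semi \<Omega> v \<noteq> 0" by blast
    have "0 \<le> dual_norm \<Omega> F * H2_semi \<Omega> v"
      using dual_norm_upper[OF F v] by linarith
    then have D: "0 \<le> dual_norm \<Omega> F"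
      using v(2) H2_semi_nonneg[OF v(1)] by (simp add: zero_le_mult_iff)
    \<comment> \<open>Scaling the small data condition by \<open>Rey * inverse Ross\<close> turns it
      into nonnegativity of the absorbed coefficient.\<close>
    have "Rey * inverse Ross * (\<Gamma>1 * dual_norm \<Omega> F) \<le> Rey * inverse Ross * (Rey powr -2 * Ross)"
      using small Rey Ross by (intro mult_left_mono) auto
    also have "\<dots> = inverse Rey"
      using Rey Ross by (simp add: powr_minus power2_eq_square field_simps)
    finally have small': "\<Gamma>1 * Rey * inverse Ross * dual_norm \<Omega> F \<le> inverse Rey"
      by (simp add: ac_simps)
    let ?c = "inverse Ross * \<Gamma>2 + 2 * inverse Rey + \<Gamma>1 * Rey * inverse Ross * dual_norm \<Omega> F"
    have c: "?c > 0"
      using Rey Ross G1 G2 D by (intro add_pos_nonneg add_pos_pos mult_nonneg_nonneg) auto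
    let ?L = "(inverse Rey - \<Gamma>1 * Rey * inverse Ross * dual_norm \<Omega> F) * H2_semi \<Omega> (\<lambda>p. \<psi> p - \<psi>\<^sub>h p)"
    have "?L \<le> ?c * H2_semi \<Omega> (\<lambda>p. \<psi> p - vh p)" if "vh \<in> Xh" for vh
      using G1_bound G2_bound psi_eq psih_eq
      by (intro best_approximation[OF Rey Ross F Xh G1 G2 _ _ psi _ psih _ D small' that]) blast+
    \<comment> \<open>Dividing by the positive constant leaves a common lower bound of the family,
      which \<open>zero\<close> shows to be nonempty.\<close>
    then have "?L / ?c \<le> (INF vh\<in>Xh. H2_semi \<Omega> (\<lambda>p. \<psi> p - vh p))"
      using zero c by (intro cINF_greatest) (auto simp: divide_le_eq mult.commute)
    then show ?thesis using c by (simp add: divide_le_eq mult.commute)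
  qed
qed

end
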